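(* Let $X=(X_t)_{t\in\mathbb{R}}$ be a real, second order, zero mean, weakly stationary random process with power spectrum $\mathscr{S}_X$ and variance $\sigma_X^2$. Let $a\in C^1(\mathbb{R})$ be real valued with $0<c_a\le a(t)\le C_a<\infty$ for all $t$, and let $\gamma\in C^2(\mathbb{R})$ be strictly increasing with $0<c_\gamma\le\gamma'(t)\le C_\gamma<\infty$ for all $t$. Define the non-stationary process $$Y_t = a(t)\sqrt{\gamma'(t)}\,X_{\gamma(t)}.$$ Let $\psi\in H^2(\mathbb{R})$ be a smooth function such that $|\psi(t)|\le 1/(1+|t|^\beta)$ for all $t$, for some $\beta>2$. Fix $q>0$ and, for $s,\tau\in\mathbb{R}$, let $\psi_{s\tau}(t)=q^{-s/2}\psi(q^{-s}(t-\tau))$. Let $\mathcal{W}_Z(s,\tau)=\langle Z,\psi_{s\tau}\rangle=\int_{\mathbb{R}} Z_t\overline{\psi_{s\tau}(t)}\,dt$ denote the wavelet transform of a process $Z$, and define $$\widetilde{\mathcal{W}}_Y(s,\tau)=a(\tau)\,\mathcal{W}_X\big(s+\log_q(\gamma'(\tau)),\gamma(\tau)\big),\qquad \varepsilon=\mathcal{W}_Y-\widetilde{\mathcal{W}}_Y .$$ Set $\rho=\frac{\beta-1}{\beta+2}$, $\mu=\frac{\beta-4}{\beta+2}$, and assume $$I_X^{(\rho)}:=\sqrt{\int_0^\infty \xi^{2\rho}\mathscr{S}_X(\xi)\,d\xi}<\infty .$$ Then $\varepsilon$ is a second order two-dimensional complex random field and, for all $s,\tau\in\mathbb{R}$, $$\mathbb{E}\{|\varepsilon(s,\tau)|^2\}\le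 C_a^2\,q^{3s}\Big(K_1\|\gamma''\|_\infty+K_2\,q^{\mu s}\|\gamma''\|_\infty^{\rho}+K_3\|a'\|_\infty\Big)^2,$$ where $$K_1=\frac{\beta\sigma_X}{2(\beta-2)\sqrt{c_\gamma}},\quad K_2=I_X^{(\rho)}\Big(\frac{\pi}{2}\Big)^{\rho}\sqrt{C_\gamma}\,\frac{4}{3\rho},\quad K_3=\frac{\sqrt{C_\gamma}\,\beta\sigma_X}{(\beta-2)c_a}.$$
   Context: The power spectrum $\mathscr{S}_X\ge 0$ is the $L^1$ function with $\mathbb{E}\{X_t X_s\}=C_X(t-s)=\int \mathscr{S}_X(\nu)e^{2i\pi\nu(t-s)}d\nu$ (the spectral measure is assumed absolutely continuous). $H^2(\mathbb{R})=\{\psi\in L^2(\mathbb{R}):\operatorname{supp}\hat\psi\subset\mathbb{R}^+\}$ (analytic wavelets), with $\hat\psi$ the Fourier transform. $\|f\|_\infty$ denotes the essential supremum of $|f|$. *)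

theory Defs
  imports "HOL-Probability.Probability"
begin

text \<open>Fourier transform (integral form; used for the analytic-wavelet condition,
  applied below only to integrable wavelets).\<close>
definition fourier :: "(real \<Rightarrow> complex) \<Rightarrow> real \<Rightarrow> complex" where
  "fourier f \<nu> = integral\<^sup>L lborel (\<lambda>t. f t * exp (- (2 * pi * \<i> * \<nu> * t)))"

definition H2 :: "(real \<Rightarrow> complex) \<Rightarrow> bool" where
  "H2 f \<longleftrightarrow> f \<in> borel_measurable lborel \<and> integrable lborel (\<lambda>t. (cmod (f t))\<^sup>2)
     \<and> closure {\<nu>. fourier f \<nu> \<noteq> 0} \<subseteq> {0..}"

definition smooth_fun :: "(real \<Rightarrow> complex) \<Rightarrow> bool" where
  "smooth_fun f \<longleftrightarrow> (\<exists>D :: nat \<Rightarrow> real \<Rightarrow> complex. D 0 = f \<and>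
     (\<forall>n t. (D n has_vector_derivative D (Suc n) t) (at t)))"

definition psi_st :: "real \<Rightarrow> (real \<Rightarrow> complex) \<Rightarrow> real \<Rightarrow> real \<Rightarrow> real \<Rightarrow> complex" where
  "psi_st q \<psi> s \<tau> t = complex_of_real (q powr (- s / 2)) * \<psi> (q powr (- s) * (t - \<tau>))"

definition wavelet :: "real \<Rightarrow> (real \<Rightarrow> complex) \<Rightarrow> (real \<Rightarrow> 'a \<Rightarrow> real) \<Rightarrow> real \<Rightarrow> real \<Rightarrow> 'a \<Rightarrow> complex" where
  "wavelet q \<psi> Z s \<tau> \<omega> = integral\<^sup>L lborel (\<lambda>t. complex_of_real (Z t \<omega>) * cnj (psi_st q \<psi> s \<tau> t))"

end

theory Submission
  imports Defs
begin

text \<open>After the substitution \<open>t = \<tau> + q\<^sup>s u\<close> the error is \<open>q\<^bsup>s/2\<^esup>\<close> times an integral of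
  \<open>(c\<^sub>1 X\<^bsub>g1\<^esub> - c\<^sub>2 X\<^bsub>g2\<^esub>) cnj \<psi>\<close>, and since the covariance is real its variance is
  \<open>\<integral> S(\<nu>) (|B(\<nu>)|\<^sup>2 + |B(-\<nu>)|\<^sup>2) / 2 d\<nu>\<close>, where \<open>B(\<nu>)\<close> is the integral of
  \<open>(c\<^sub>1 e\<^bsup>2\<pi>i\<nu>g1\<^esup> - c\<^sub>2 e\<^bsup>2\<pi>i\<nu>g2\<^esup>) cnj \<psi>\<close>.

  Bounding \<open>|B(\<nu>)|\<close> and \<open>|B(-\<nu>)|\<close> separately by the triangle inequality loses a factor
  \<open>\<surd>2\<close> in \<open>K\<^sub>2\<close>, because both half lines carry spectral mass. The pair is therefore treated
  jointly: by duality its norm is an \<open>L\<^sup>1\<close> norm, a weighted Cauchy--Schwarz inequality turns this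
  into a quadratic form, and the off-diagonal term \<open>\<integral> w U\<^sup>2\<close> (for \<open>U\<close> the difference of the two
  exponentials with amplitudes \<open>\<surd>\<gamma>'\<close>) is oscillatory. The amplitude \<open>\<surd>\<gamma>'\<close> makes \<open>U\<^sup>2\<close> an exact
  derivative up to a term of the size of the \<open>K\<^sub>1\<close> contribution, so what is lost is absorbed by the
  cross term between the \<open>K\<^sub>1\<close> and \<open>K\<^sub>2\<close> contributions.

  Finally \<open>\<integral> min(x u\<^sup>2, 1) / (1 + |u|\<^sup>\<beta>) du\<close> is split at \<open>x\<^bsup>-1/(\<beta>+2)\<^esup>\<close>, which produces the exponent
  \<open>\<rho>\<close>, and the frequencies are recombined by Minkowski's inequality in \<open>L\<^sup>2(S)\<close>.\<close>

subsection \<open>Weighted integrals with a decreasing weight\<close>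

text \<open>\<open>w u\<close> is the length of the set of levels \<open>z\<close> with
  \<open>0 < z < w u\<close>, so Fubini on the region under the graph of \<open>w\<close> writes the
  weighted integral as a superposition of unweighted integrals over superlevel sets. Integrability
  in \<open>z\<close> is recorded because the next lemma compares two such superpositions level by
  level.\<close>

lemma integral_layer_cake:
  fixes h :: "real \<Rightarrow> 'b::{banach, second_countable_topology}" and w :: "real \<Rightarrow> real"
  assumes [measurable]: "h \<in> borel_measurable borel" "w \<in> borel_measurable borel"
    and w_nonneg: "\<forall>u>0. 0 \<le> w u"
    and int: "set_integrable lborel {0<..} (\<lambda>u. w u *\<^sub>R h u)"
  shows "integrable lborel (\<lambda>z. LBINT u:{u. 0 < u \<and> 0 < z \<and> z < w u}. h u)"
    and "(\<integral>z. (LBINT u:{u. 0 < u \<and> 0 < z \<and> z < w u}. h u) \<partial>lborel) = (LBINT u:{0<..}. w u *\<^sub>R h u)"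
proof -
  define G where "G = (\<lambda>u z. indicat_real {p. 0 < fst p \<and> 0 < snd p \<and> snd p < w (fst p)} (u, z) *\<^sub>R h u)"
  have G_meas: "case_prod G \<in> borel_measurable (lborel \<Otimes>\<^sub>M lborel)"
    unfolding G_def by measurable
  have G_u: "G u z = indicat_real {0<..<w u} z *\<^sub>R (indicat_real {0<..} u *\<^sub>R h u)" for u z
    by (auto simp: G_def indicator_def)
  have slice: "(\<integral>z. indicat_real {0<..<w u} z *\<^sub>R c \<partial>lborel) = w u *\<^sub>R c"
    if "0 < u" for u and c :: "'d::{banach, second_countable_topology}"
    using w_nonneg that by simp
  have G_int_z: "integrable lborel (G u)" for u
    unfolding G_u by (cases "0 < w u") (auto intro!: integrable_scaleR_left)
  have eq: "(\<integral>z. G u z \<partial>lborel) = indicat_real {0<..} u *\<^sub>R (w u *\<^sub>R h u)" for u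
    unfolding G_u using slice[of u "h u"] by (cases "0 < u") auto
  have eqn: "(\<integral>z. norm (G u z) \<partial>lborel) = norm (indicat_real {0<..} u *\<^sub>R (w u *\<^sub>R h u))" for u
    unfolding G_u using slice[of u "norm (h u)"] w_nonneg by (cases "0 < u") auto
  have G_int: "integrable (lborel \<Otimes>\<^sub>M lborel) (case_prod G)"
  proof (rule lborel_pair.Fubini_integrable[OF G_meas])
    show "integrable lborel (\<lambda>u. \<integral>z. norm (case_prod G (u, z)) \<partial>lborel)"
      using int unfolding set_integrable_def by (simp add: eqn integrable_norm del: norm_scaleR)
    show "AE u in lborel. integrable lborel (\<lambda>z. case_prod G (u, z))"
      using G_int_z by simp
  qed
  have inner: "(\<integral>u. G u z \<partial>lborel) = (LBINT u:{u. 0 < u \<and> 0 < z \<and> z < w u}. h u)" for z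
    unfolding set_lebesgue_integral_def G_def by (intro Bochner_Integration.integral_cong) (auto simp: indicator_def)
  show "integrable lborel (\<lambda>z. LBINT u:{u. 0 < u \<and> 0 < z \<and> z < w u}. h u)"
    using lborel_pair.integrable_snd[OF G_int] by (simp add: inner)
  show "(\<integral>z. (LBINT u:{u. 0 < u \<and> 0 < z \<and> z < w u}. h u) \<partial>lborel) = (LBINT u:{0<..}. w u *\<^sub>R h u)"
    using lborel_pair.Fubini_integral[OF G_int] by (simp add: inner eq set_lebesgue_integral_def)
qed

text \<open>Superlevel sets of a decreasing weight are initial intervals up to an endpoint, so a
  bound on all initial intervals holds at every level and survives integration over the levels. This
  does the work of an integration by parts against \<open>w\<close>. The hypothesis
  \<open>w_lim\<close> keeps the superlevel sets at positive height bounded, so that they have a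
  right endpoint.\<close>

lemma norm_integral_antimono_weight_le:
  fixes f :: "real \<Rightarrow> 'b::{banach, second_countable_topology}" and \<eta> w :: "real \<Rightarrow> real"
  assumes meas: "f \<in> borel_measurable borel" "\<eta> \<in> borel_measurable borel" "w \<in> borel_measurable borel"
    and w_nonneg: "\<And>u. 0 < u \<Longrightarrow> 0 \<le> w u"
    and w_anti: "\<And>u v. 0 < u \<Longrightarrow> u \<le> v \<Longrightarrow> w v \<le> w u"
    and w_lim: "\<And>z. 0 < z \<Longrightarrow> \<exists>c. \<forall>u>0. z < w u \<longrightarrow> u \<le> c"
    and int_f: "set_integrable lborel {0<..} (\<lambda>u. w u *\<^sub>R f u)"
    and int_\<eta>: "set_integrable lborel {0<..} (\<lambda>u. w u * \<eta> u)"
    and bound: "\<And>v. 0 < v \<Longrightarrow> norm (LBINT u:{0<..v}. f u) \<le> (LBINT u:{0<..v}. \<eta> u)"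
  shows "norm (LBINT u:{0<..}. w u *\<^sub>R f u) \<le> (LBINT u:{0<..}. w u * \<eta> u)"
proof -
  have w_nonneg': "\<forall>u>0. 0 \<le> w u" using w_nonneg by blast
  note F = integral_layer_cake[OF meas(1,3) w_nonneg' int_f]
  note H = integral_layer_cake[OF meas(2,3) w_nonneg' int_\<eta>[folded real_scaleR_def], unfolded real_scaleR_def]
  have level: "norm (LBINT u:{u. 0 < u \<and> 0 < z \<and> z < w u}. f u)
      \<le> (LBINT u:{u. 0 < u \<and> 0 < z \<and> z < w u}. \<eta> u)" for z
  proof -
    define A where "A = {u. 0 < u \<and> 0 < z \<and> z < w u}"
    show ?thesis
    proof (cases "A = {}")
      case True
      then show ?thesis by (simp add: A_def[symmetric] set_lebesgue_integral_def)
    next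
      case False
      then obtain u0 where u0: "u0 \<in> A" by blast
      then have z: "0 < z" by (simp add: A_def)
      obtain c where c: "\<And>u. 0 < u \<Longrightarrow> z < w u \<Longrightarrow> u \<le> c" using w_lim[OF z] by blast
      have bdd: "bdd_above A" using c by (auto simp: A_def intro!: bdd_aboveI)
      \<comment> \<open>Whether \<open>v\<close> itself lies in \<open>A\<close> is left open:
        \<open>A\<close> is caught between the open and the right-closed interval, which differ by a
        null set.\<close>
      define v where "v = Sup A"
      have v: "0 < v" using cSup_upper[OF u0 bdd] u0 by (simp add: v_def A_def)
      have sub: "A \<subseteq> {0<..v}" using cSup_upper[OF _ bdd] by (auto simp: v_def A_def)
      have sup: "{0<..<v} \<subseteq> A"
      proof
        fix u assume u: "u \<in> {0<..<v}"
        then obtain u1 where "u1 \<in> A" "u < u1" using less_cSup_iff[OF False bdd] by (auto simp: v_def)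
        then show "u \<in> A" using w_anti[of u u1] u by (auto simp: A_def)
      qed
      have AEeq: "AE u in lborel. indicat_real A u = indicat_real {0<..v} u"
        using AE_lborel_singleton[of v]
      proof eventually_elim
        case (elim u)
        have "u \<in> A \<longleftrightarrow> u \<in> {0<..v}" using sub sup elim
          by (metis greaterThanAtMost_iff greaterThanLessThan_iff order_le_less subset_iff)
        then show ?case by (simp add: indicator_def)
      qed
      have [measurable]: "A \<in> sets borel" using meas(3) by (simp add: A_def)
      note [measurable] = meas
      have "(LBINT u:A. f u) = (LBINT u:{0<..v}. f u)"
        unfolding set_lebesgue_integral_def using AEeq by (intro integral_cong_AE) auto
      moreover have "(LBINT u:A. \<eta> u) = (LBINT u:{0<..v}. \<eta> u)"
        unfolding set_lebesgue_integral_def using AEeq by (intro integral_cong_AE) auto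
      ultimately show ?thesis using bound[OF v] by (simp add: A_def[symmetric])
    qed
  qed
  have "norm (LBINT u:{0<..}. w u *\<^sub>R f u)
      = norm (\<integral>z. (LBINT u:{u. 0 < u \<and> 0 < z \<and> z < w u}. f u) \<partial>lborel)"
    using F(2) by simp
  also have "\<dots> \<le> (\<integral>z. (LBINT u:{u. 0 < u \<and> 0 < z \<and> z < w u}. \<eta> u) \<partial>lborel)"
    using F(1) H(1) level by (intro Bochner_Integration.integral_norm_bound_integral) auto
  also have "\<dots> = (LBINT u:{0<..}. w u * \<eta> u)" using H(2) by simp
  finally show ?thesis .
qed

section \<open>Phase identities and an antiderivative for the oscillating square\<close>

lemma norm_exp_i_diff: "cmod (exp (\<i> * of_real a) - exp (\<i> * of_real b)) = 2 * \<bar>sin ((a - b) / 2)\<bar>"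
proof -
  have "exp (\<i> * of_real a) - exp (\<i> * of_real b) = exp (\<i> * of_real b) * (exp (\<i> * of_real (a - b)) - 1)"
    by (simp add: right_diff_distrib flip: exp_add)
  then have "cmod (exp (\<i> * of_real a) - exp (\<i> * of_real b)) = cmod (exp (\<i> * of_real (a - b)) - 1)"
    by (simp add: norm_mult)
  also have "\<dots> = 2 * \<bar>sin ((a - b) / 2)\<bar>"
    using dist_exp_i_1[of "a - b"] by (simp add: dist_norm)
  finally show ?thesis .
qed

text \<open>The middle term of the expanded square, \<open>-2 \<alpha> b\<close>, differs from the one produced by the
  derivative, \<open>-(\<alpha>\<^sup>2 + b\<^sup>2)\<close>, by the small quantity \<open>(\<alpha> - b)\<^sup>2\<close>.\<close>
lemma square_eq_deriv_plus:
  fixes \<alpha> \<Gamma> :: "real \<Rightarrow> real" and b l :: real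
  assumes l: "l \<noteq> 0" and \<Gamma>: "(\<Gamma> has_real_derivative l * (\<alpha> u)\<^sup>2) (at u)"
  defines "F \<equiv> \<lambda>u. (exp (\<i> * of_real (\<Gamma> u)) - exp (\<i> * of_real (l * b\<^sup>2 * u)))\<^sup>2 / (2 * \<i> * of_real l)"
  shows "(F has_vector_derivative
      ((of_real (\<alpha> u) * exp (\<i> * of_real (\<Gamma> u)) - of_real b * exp (\<i> * of_real (l * b\<^sup>2 * u)))\<^sup>2
        - of_real ((\<alpha> u - b)\<^sup>2) * exp (\<i> * of_real (\<Gamma> u + l * b\<^sup>2 * u)))) (at u)"
proof -
  define E1 where "E1 = exp (\<i> * of_real (\<Gamma> u))"
  define E2 where "E2 = exp (\<i> * of_real (l * b\<^sup>2 * u))"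
  have d1: "((\<lambda>u. exp (\<i> * of_real (\<Gamma> u))) has_vector_derivative (\<i> * of_real (l * (\<alpha> u)\<^sup>2) * E1)) (at u)"
  proof -
    have "((\<lambda>u. of_real (\<Gamma> u) :: complex) has_vector_derivative of_real (l * (\<alpha> u)\<^sup>2)) (at u)"
      using \<Gamma> by (intro has_vector_derivative_of_real) (simp add: has_real_derivative_iff_has_vector_derivative)
    then have "((\<lambda>u. \<i> * of_real (\<Gamma> u)) has_vector_derivative \<i> * of_real (l * (\<alpha> u)\<^sup>2)) (at u)"
      by (rule has_vector_derivative_mult_right)
    from field_vector_diff_chain_at[OF this, of exp "E1"]
    show ?thesis by (simp add: E1_def o_def DERIV_exp)
  qed
  have d2: "((\<lambda>u. exp (\<i> * of_real (l * b\<^sup>2 * u))) has_vector_derivative (\<i> * of_real (l * b\<^sup>2) * E2)) (at u)"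
  proof -
    have "((\<lambda>u. of_real (l * b\<^sup>2 * u) :: complex) has_vector_derivative of_real (l * b\<^sup>2)) (at u)"
      by (intro has_vector_derivative_of_real)
        (auto simp: has_real_derivative_iff_has_vector_derivative[symmetric] intro!: derivative_eq_intros)
    then have "((\<lambda>u. \<i> * of_real (l * b\<^sup>2 * u)) has_vector_derivative \<i> * of_real (l * b\<^sup>2)) (at u)"
      by (rule has_vector_derivative_mult_right)
    from field_vector_diff_chain_at[OF this, of exp "E2"]
    show ?thesis by (simp add: E2_def o_def DERIV_exp)
  qed
  define G where "G = (\<lambda>u. exp (\<i> * of_real (\<Gamma> u)) - exp (\<i> * of_real (l * b\<^sup>2 * u)))"
  have dG: "(G has_vector_derivative (\<i> * of_real (l * (\<alpha> u)\<^sup>2) * E1 - \<i> * of_real (l * b\<^sup>2) * E2)) (at u)"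
    unfolding G_def by (rule has_vector_derivative_diff[OF d1 d2])
  have "((\<lambda>u. G u * G u / (2 * \<i> * of_real l)) has_vector_derivative
     (G u * (\<i> * of_real (l * (\<alpha> u)\<^sup>2) * E1 - \<i> * of_real (l * b\<^sup>2) * E2)
      + (\<i> * of_real (l * (\<alpha> u)\<^sup>2) * E1 - \<i> * of_real (l * b\<^sup>2) * E2) * G u) / (2 * \<i> * of_real l)) (at u)"
    by (intro has_vector_derivative_divide has_vector_derivative_mult dG)
  also have "(\<lambda>u. G u * G u / (2 * \<i> * of_real l)) = F"
    by (simp add: F_def G_def power2_eq_square)
  also have "(G u * (\<i> * of_real (l * (\<alpha> u)\<^sup>2) * E1 - \<i> * of_real (l * b\<^sup>2) * E2)
      + (\<i> * of_real (l * (\<alpha> u)\<^sup>2) * E1 - \<i> * of_real (l * b\<^sup>2) * E2) * G u) / (2 * \<i> * of_real l)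
    = (of_real (\<alpha> u) * E1 - of_real b * E2)\<^sup>2 - of_real ((\<alpha> u - b)\<^sup>2) * (E1 * E2)"
    using l unfolding G_def E1_def[symmetric] E2_def[symmetric] by (simp add: field_simps power2_eq_square)
  finally show ?thesis
    unfolding E1_def E2_def by (simp add: exp_add algebra_simps)
qed

subsection \<open>Pairs of oscillatory integrals\<close>

text \<open>On the positive half line \<open>K * u\<^sup>2 / 2 - g u\<close> is nondecreasing. Signs
  and reflections reduce everything to this one-sided fact, applied to \<open>f\<close>, to
  \<open>- f\<close> and to their mirror images.\<close>

lemma quadratic_bound_of_deriv_bound:
  fixes f f' :: "real \<Rightarrow> real"
  assumes f0: "f 0 = 0" and df: "\<And>u. (f has_real_derivative f' u) (at u)"
    and bd: "\<And>u. \<bar>f' u\<bar> \<le> K * \<bar>u\<bar>"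
  shows "\<bar>f u\<bar> \<le> K * u\<^sup>2 / 2"
proof -
  have pos: "g u \<le> K * u\<^sup>2 / 2"
    if "0 \<le> u" "g 0 = 0" and dg: "\<And>u. (g has_real_derivative g' u) (at u)" and bg: "\<And>u. \<bar>g' u\<bar> \<le> K * \<bar>u\<bar>"
    for g g' :: "real \<Rightarrow> real" and u :: real
  proof -
    have "(\<lambda>u. K * u\<^sup>2 / 2 - g u) 0 \<le> (\<lambda>u. K * u\<^sup>2 / 2 - g u) u"
    proof (rule DERIV_nonneg_imp_nondecreasing[OF \<open>0 \<le> u\<close>])
      fix v :: real assume v: "0 \<le> v"
      have "((\<lambda>u. K * u\<^sup>2 / 2 - g u) has_real_derivative (K * v - g' v)) (at v)"
        by (auto intro!: derivative_eq_intros dg)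
      moreover have "0 \<le> K * v - g' v" using bg[of v] v by simp
      ultimately show "\<exists>y. ((\<lambda>u. K * u\<^sup>2 / 2 - g u) has_real_derivative y) (at v) \<and> 0 \<le> y" by blast
    qed
    then show ?thesis using that(2) by simp
  qed
  have dneg: "((\<lambda>u. f (- u)) has_real_derivative - f' (- u)) (at u)" for u
    using df[of "- u"] by (simp add: DERIV_mirror)
  have dm: "((\<lambda>u. - f u) has_real_derivative - f' u) (at u)" for u
    using df[of u] by (rule DERIV_minus)
  have dmneg: "((\<lambda>u. - f (- u)) has_real_derivative - (- f' (- u))) (at u)" for u
    using dneg[of u] by (rule DERIV_minus)
  show ?thesis
  proof (cases "0 \<le> u")
    case True
    have "f u \<le> K * u\<^sup>2 / 2" using pos[OF True f0 df bd] .
    moreover have "- f u \<le> K * u\<^sup>2 / 2"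
      using pos[of u "\<lambda>u. - f u", OF True _ dm] f0 bd by simp
    ultimately show ?thesis by simp
  next
    case False
    then have u: "0 \<le> - u" by simp
    have "f (- (- u)) \<le> K * (- u)\<^sup>2 / 2"
      using pos[of "- u" "\<lambda>u. f (- u)", OF u _ dneg] f0 bd by (metis abs_minus_cancel minus_zero)
    moreover have "- f (- (- u)) \<le> K * (- u)\<^sup>2 / 2"
      using pos[of "- u" "\<lambda>u. - f (- u)", OF u _ dmneg] f0 bd by (metis abs_minus_cancel minus_zero)
    ultimately show ?thesis by simp
  qed
qed

text \<open>The law of cosines, with 1 - cos rewritten through the half angle, so that amplitude
  mismatch and phase mismatch appear as separate squares.\<close>

lemma cmod_diff_rotations_sq:
  "(cmod (of_real a * exp (\<i> * of_real s) - of_real b * exp (\<i> * of_real t)))\<^sup>2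
    = (a - b)\<^sup>2 + 4 * a * b * (sin ((s - t) / 2))\<^sup>2"
proof -
  have "(cmod (of_real a * exp (\<i> * of_real s) - of_real b * exp (\<i> * of_real t)))\<^sup>2
    = (a * cos s - b * cos t)\<^sup>2 + (a * sin s - b * sin t)\<^sup>2"
    by (simp add: cmod_power2 flip: cis_conv_exp)
  also have "\<dots> = a\<^sup>2 * ((sin s)\<^sup>2 + (cos s)\<^sup>2) + b\<^sup>2 * ((sin t)\<^sup>2 + (cos t)\<^sup>2) - 2 * a * b * cos (s - t)"
    unfolding cos_diff by algebra
  also have "\<dots> = a\<^sup>2 + b\<^sup>2 - 2 * a * b * cos (2 * ((s - t) / 2))"
    unfolding sin_cos_squared_add by (subst mult_2) simp
  also have "\<dots> = (a - b)\<^sup>2 + 4 * a * b * (sin ((s - t) / 2))\<^sup>2"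
    unfolding cos_double_sin by (simp add: power2_eq_square algebra_simps)
  finally show ?thesis .
qed

text \<open>Time is recentred and rescaled: \<open>\<alpha>\<close> will be the square root of
  \<gamma>' along the new time, \<open>\<Gamma>\<close> the phase increment of one positive
  frequency, and \<open>e\<close> the decay envelope of the wavelet. The condition
  \<open>\<Gamma>_deriv\<close> says that the squared amplitude is proportional to the phase speed,
  which is what makes the square of the error nearly an exact derivative.\<close>

locale warped_exponential =
  fixes l b lo hi n :: real and \<alpha> \<Gamma> :: "real \<Rightarrow> real" and e :: "real \<Rightarrow> real"
  assumes l: "0 < l" and lo: "0 < lo" and n: "0 < n"
    and \<alpha>_cont: "continuous_on UNIV \<alpha>"
    and \<alpha>_lo: "\<And>u. lo \<le> \<alpha> u" and \<alpha>_hi: "\<And>u. \<alpha> u \<le> hi" and \<alpha>_0: "\<alpha> 0 = b"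
    and \<alpha>_lip: "\<And>u. \<bar>(\<alpha> u)\<^sup>2 - b\<^sup>2\<bar> \<le> n * \<bar>u\<bar>"
    and \<Gamma>_0: "\<Gamma> 0 = 0" and \<Gamma>_deriv: "\<And>u. (\<Gamma> has_real_derivative l * (\<alpha> u)\<^sup>2) (at u)"
    and e_meas [measurable]: "e \<in> borel_measurable borel"
    and e_nonneg: "\<And>u. 0 \<le> e u" and e_even: "\<And>u. e (- u) = e u" and e_le_1: "\<And>u. e u \<le> 1"
    and e_anti: "\<And>u v. 0 < u \<Longrightarrow> u \<le> v \<Longrightarrow> e v \<le> e u"
    and e_int: "integrable lborel e" and e_int1: "integrable lborel (\<lambda>u. \<bar>u\<bar> * e u)"
begin

text \<open>\<open>U\<close> is the error of replacing the warped exponential by its tangent one at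
  0. The next two functions majorise its two sources: \<open>p\<close> the change of amplitude,
  \<open>r\<close> the change of phase.\<close>

definition "U u = of_real (\<alpha> u) * exp (\<i> * of_real (\<Gamma> u)) - of_real b * exp (\<i> * of_real (l * b\<^sup>2 * u))"
definition "p u = n * \<bar>u\<bar> / (2 * lo)"
definition "r u = 2 * hi * min (l * n / 4 * u\<^sup>2) 1"
text \<open>The factor \<open>sqrt 2\<close> sits on \<open>p\<close> only; \<open>k\<^sup>2\<close>
  is designed to dominate the diagonal and off-diagonal parts of the quadratic form together, see
  \<open>quadratic_form_le\<close>.\<close>

definition "k u = sqrt 2 * p u + r u"
text \<open>At \<open>u = 0\<close> the denominator vanishes and \<open>w 0 = 0\<close> by the
  convention for division; this is consistent because \<open>U 0 = 0\<close>.\<close>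

definition "w u = e u / k u"

lemma b_bounds: "lo \<le> b" "b \<le> hi" "0 < b" "0 < hi" "lo \<le> hi"
  using \<alpha>_lo[of 0] \<alpha>_hi[of 0] \<alpha>_0 lo by auto

lemma p_nonneg: "0 \<le> p u" using n lo by (simp add: p_def)
lemma r_nonneg: "0 \<le> r u" using b_bounds l n by (simp add: r_def)
lemma k_nonneg: "0 \<le> k u" using p_nonneg r_nonneg by (simp add: k_def)
lemma k_pos: "u \<noteq> 0 \<Longrightarrow> 0 < k u"
  using n lo r_nonneg[of u] by (auto simp: k_def p_def intro!: add_pos_nonneg)
lemma w_nonneg: "0 \<le> w u" using k_nonneg e_nonneg by (simp add: w_def)

lemma \<Gamma>_cont: "continuous_on UNIV \<Gamma>"
  using \<Gamma>_deriv by (meson DERIV_isCont continuous_at_imp_continuous_on)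

lemma U_cont: "continuous_on UNIV U"
  unfolding U_def by (intro continuous_intros \<alpha>_cont \<Gamma>_cont)

lemma U_meas [measurable]: "U \<in> borel_measurable borel"
  using U_cont by (rule borel_measurable_continuous_onI)

lemma p_meas [measurable]: "p \<in> borel_measurable borel" unfolding p_def[abs_def] by measurable
lemma r_meas [measurable]: "r \<in> borel_measurable borel" unfolding r_def[abs_def] by measurable
lemma k_meas [measurable]: "k \<in> borel_measurable borel" unfolding k_def[abs_def] by measurable
lemma w_meas [measurable]: "w \<in> borel_measurable borel" unfolding w_def[abs_def] by measurable

text \<open>The Lipschitz bound is on squares; dividing by \<alpha> u + b, which is at least
  \<open>2 * lo\<close>, transfers it to \<alpha>.\<close>

lemma \<alpha>_diff: "\<bar>\<alpha> u - b\<bar> \<le> p u"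
proof -
  have "\<bar>\<alpha> u - b\<bar> * (2 * lo) \<le> \<bar>\<alpha> u - b\<bar> * (\<alpha> u + b)"
    using \<alpha>_lo[of u] b_bounds by (intro mult_left_mono) auto
  also have "\<dots> = \<bar>(\<alpha> u)\<^sup>2 - b\<^sup>2\<bar>"
    using \<alpha>_lo[of u] b_bounds lo by (simp add: power2_eq_square square_diff_square_factored abs_mult)
  also have "\<dots> \<le> n * \<bar>u\<bar>" by (rule \<alpha>_lip)
  finally show ?thesis using lo by (simp add: p_def field_simps)
qed

text \<open>The phase difference has derivative
  \<open>l * ((\<alpha> u)\<^sup>2 - b\<^sup>2)\<close>. Integrating its linear bound gives one
  factor 1/2 and the half angle the other, hence the 4.\<close>

lemma sin_phase: "\<bar>sin ((\<Gamma> u - l * b\<^sup>2 * u) / 2)\<bar> \<le> min (l * n / 4 * u\<^sup>2) 1"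
proof -
  have "\<bar>\<Gamma> u - l * b\<^sup>2 * u\<bar> \<le> (l * n) * u\<^sup>2 / 2"
  proof (rule quadratic_bound_of_deriv_bound[where f' = "\<lambda>u. l * ((\<alpha> u)\<^sup>2 - b\<^sup>2)"])
    show "((\<lambda>u. \<Gamma> u - l * b\<^sup>2 * u) has_real_derivative l * ((\<alpha> u)\<^sup>2 - b\<^sup>2)) (at u)" for u
      by (auto intro!: derivative_eq_intros \<Gamma>_deriv simp: algebra_simps)
    show "\<bar>l * ((\<alpha> u)\<^sup>2 - b\<^sup>2)\<bar> \<le> l * n * \<bar>u\<bar>" for u
      using \<alpha>_lip[of u] l by (simp add: abs_mult)
  qed (simp add: \<Gamma>_0)
  moreover have "\<bar>sin ((\<Gamma> u - l * b\<^sup>2 * u) / 2)\<bar> \<le> \<bar>(\<Gamma> u - l * b\<^sup>2 * u) / 2\<bar>"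
    by (rule abs_sin_x_le_abs_x)
  ultimately show ?thesis by auto
qed

text \<open>The majorants add in squares and not as \<open>(p u + r u)\<^sup>2\<close>; the saved
  \<open>2 * p u * r u\<close> is what pays for the off-diagonal term.\<close>

lemma U_sq_le: "(cmod (U u))\<^sup>2 \<le> (p u)\<^sup>2 + (r u)\<^sup>2"
proof -
  have "(cmod (U u))\<^sup>2 = (\<alpha> u - b)\<^sup>2 + 4 * (\<alpha> u * b) * (sin ((\<Gamma> u - l * b\<^sup>2 * u) / 2))\<^sup>2"
    using cmod_diff_rotations_sq[of "\<alpha> u" "\<Gamma> u" b "l * b\<^sup>2 * u"] by (simp add: U_def mult.assoc)
  moreover have "(\<alpha> u - b)\<^sup>2 \<le> (p u)\<^sup>2"
    using \<alpha>_diff[of u] p_nonneg[of u] by (simp add: abs_le_square_iff[symmetric])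
  moreover have "(sin ((\<Gamma> u - l * b\<^sup>2 * u) / 2))\<^sup>2 \<le> (min (l * n / 4 * u\<^sup>2) 1)\<^sup>2"
    using sin_phase[of u] by (simp add: abs_le_square_iff[symmetric])
  moreover have "\<alpha> u * b \<le> hi * hi" using \<alpha>_hi[of u] \<alpha>_lo[of u] b_bounds lo by (intro mult_mono) auto
  ultimately have "(cmod (U u))\<^sup>2 \<le> (p u)\<^sup>2 + 4 * (hi * hi) * (min (l * n / 4 * u\<^sup>2) 1)\<^sup>2"
    by (smt (verit, ccfv_SIG) mult_mono zero_le_power2 mult_nonneg_nonneg b_bounds \<alpha>_lo[of u] lo)
  also have "\<dots> = (p u)\<^sup>2 + (r u)\<^sup>2" by (simp add: r_def power_mult_distrib power2_eq_square)
  finally show ?thesis .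
qed

text \<open>By \<open>square_eq_deriv_plus\<close> the integral is a boundary term
  \<open>F v\<close> plus the integral of a remainder \<open>R\<close> of size at most
  \<open>p\<^sup>2\<close>. The boundary term is of order 1 / l times a squared sine, and is
  rewritten as an integral so that both parts have the shape required by the level-set
  comparison.\<close>

lemma integral_U_sq:
  assumes v: "0 < v"
  shows "norm (LBINT u:{0<..v}. (U u)\<^sup>2) \<le> (LBINT u:{0<..v}. (p u)\<^sup>2 + 2 * p u * r u)"
proof -
  let ?m = "\<lambda>u. min (l * n / 4 * u\<^sup>2) 1"
  define F where "F = (\<lambda>u. (exp (\<i> * of_real (\<Gamma> u)) - exp (\<i> * of_real (l * b\<^sup>2 * u)))\<^sup>2 / (2 * \<i> * of_real l))"
  define R where "R = (\<lambda>u. of_real ((\<alpha> u - b)\<^sup>2) * exp (\<i> * of_real (\<Gamma> u + l * b\<^sup>2 * u)))"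
  have contR: "continuous_on UNIV R"
    unfolding R_def by (intro continuous_intros \<alpha>_cont \<Gamma>_cont)
  have contU: "continuous_on UNIV (\<lambda>u. (U u)\<^sup>2)" by (intro continuous_intros U_cont)
  have contp: "continuous_on UNIV (\<lambda>u. (p u)\<^sup>2)" unfolding p_def by (intro continuous_intros) (use lo in auto)
  have contpr: "continuous_on UNIV (\<lambda>u. 2 * p u * r u)" unfolding p_def r_def by (intro continuous_intros) (use lo in auto)
  have si: "set_integrable lborel {0<..v} g" if "continuous_on UNIV g" for v and g :: "real \<Rightarrow> 'z::euclidean_space"
    by (rule set_integrable_subset[of _ "{0..v}"])
      (auto intro!: borel_integrable_compact continuous_on_subset[OF that] simp: set_integrable_def)
  \<comment> \<open>The fundamental theorem of calculus is used on closed intervals, while the level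
    sets give half-open ones; the point 0 is null.\<close>
  have oc: "(LBINT u:{0<..v}. g u) = (LBINT u:{0..v}. g u)" if "continuous_on UNIV g" for v and g :: "real \<Rightarrow> 'z::euclidean_space"
  proof (rule set_integral_cong_set[symmetric])
    have [measurable]: "g \<in> borel_measurable borel" using that by (rule borel_measurable_continuous_onI)
    show "set_borel_measurable lborel {0<..v} g" "set_borel_measurable lborel {0..v} g"
      by (auto simp: set_borel_measurable_def)
    show "AE x in lborel. (x \<in> {0<..v}) \<longleftrightarrow> (x \<in> {0..v})"
      using AE_lborel_singleton[of 0] by eventually_elim auto
  qed
  have "(LBINT u:{0<..v}. (U u)\<^sup>2 - R u) = F v - F 0"
    unfolding oc[OF continuous_on_diff[OF contU contR]] unfolding set_lebesgue_integral_def
  proof (rule integral_FTC_Icc)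
    show "(F has_vector_derivative (U u)\<^sup>2 - R u) (at u within {0..v})" for u
      using square_eq_deriv_plus[where l = l and \<Gamma> = \<Gamma> and \<alpha> = \<alpha> and b = b and u = u] \<Gamma>_deriv[of u] l
      by (auto simp: F_def U_def R_def intro: has_vector_derivative_at_within)
    show "continuous_on {0..v} (\<lambda>u. (U u)\<^sup>2 - R u)"
      by (intro continuous_intros continuous_on_subset[OF contR] continuous_on_subset[OF contU]) auto
  qed (use v in auto)
  moreover have F0: "F 0 = 0" by (simp add: F_def \<Gamma>_0)
  ultimately have eq: "(LBINT u:{0<..v}. (U u)\<^sup>2) = F v + (LBINT u:{0<..v}. R u)"
    using si[OF contU] si[OF contR] F0 by (simp add: set_integral_diff diff_eq_eq)
  have "norm (F v) = (2 * \<bar>sin ((\<Gamma> v - l * b\<^sup>2 * v) / 2)\<bar>)\<^sup>2 / (2 * l)"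
    using l by (simp only: F_def norm_divide norm_power norm_exp_i_diff) (simp add: norm_mult)
  also have "\<dots> \<le> (2 * ?m v)\<^sup>2 / (2 * l)"
    using l sin_phase[of v] by (intro divide_right_mono power_mono) auto
  also have "\<dots> = 2 / l * (?m v)\<^sup>2" using l by (simp add: power_mult_distrib field_simps)
  also have "\<dots> \<le> (LBINT u:{0<..v}. 2 * p u * r u)"
  proof -
    \<comment> \<open>\<open>T\<close> is the point of (0, v] at which the truncation saturates, or
      \<open>v\<close> if it never does: the minimum at \<open>v\<close> equals
      \<open>l * n / 4 * T\<^sup>2\<close>, and it is inactive on (0, T]. There
      \<open>2 * p u * r u\<close> is \<open>hi / lo \<ge> 1\<close> times the cubic
      \<open>l * n\<^sup>2 / 2 * u^3\<close>, whose integral up to \<open>T\<close> is exactly the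
      bound on the boundary term.\<close>
    define T where "T = min v (1 / sqrt (l * n / 4))"
    have x: "0 < l * n / 4" using l n by simp
    have T: "0 < T" "T \<le> v" "l * n / 4 * T\<^sup>2 \<le> 1"
    proof -
      have "T\<^sup>2 \<le> (1 / sqrt (l * n / 4))\<^sup>2" using v x unfolding T_def by (intro power_mono) auto
      then show "l * n / 4 * T\<^sup>2 \<le> 1" using x by (simp add: power_divide field_simps)
    qed (use v x in \<open>auto simp: T_def\<close>)
    have mT: "?m v = l * n / 4 * T\<^sup>2"
    proof (cases "v \<le> 1 / sqrt (l * n / 4)")
      case True then show ?thesis using T by (simp add: T_def min_absorb1)
    next
      case False
      define y where "y = l * n / 4"
      have y: "0 < y" using x by (simp add: y_def)
      have "1 / y \<le> v\<^sup>2"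
        using power_mono[of "1 / sqrt y" v 2] False y by (simp add: y_def[symmetric] power_divide)
      then have "1 \<le> y * v\<^sup>2" using y by (simp add: field_simps)
      moreover have "T\<^sup>2 = 1 / y" using False y by (simp add: T_def y_def[symmetric] power_divide)
      ultimately show ?thesis using y by (simp add: y_def[symmetric])
    qed
    have "(LBINT u:{0..T}. l * n\<^sup>2 / 2 * u^3) = l * n\<^sup>2 / 8 * T^4 - l * n\<^sup>2 / 8 * 0^4"
      unfolding set_lebesgue_integral_def
    proof (rule integral_FTC_Icc)
      show "((\<lambda>u. l * n\<^sup>2 / 8 * u ^ 4) has_vector_derivative l * n\<^sup>2 / 2 * u ^ 3) (at u within {0..T})" for u
        unfolding has_real_derivative_iff_has_vector_derivative[symmetric]
        by (auto intro!: derivative_eq_intros)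
    qed (use T in \<open>auto intro!: continuous_intros\<close>)
    then have I: "(LBINT u:{0<..T}. l * n\<^sup>2 / 2 * u^3) = l * n\<^sup>2 / 8 * T^4"
      by (subst oc) (auto intro!: continuous_intros)
    have "2 / l * (?m v)\<^sup>2 = (LBINT u:{0<..T}. l * n\<^sup>2 / 2 * u^3)"
      unfolding I mT using l by (simp add: power2_eq_square field_simps power4_eq_xxxx)
    also have "\<dots> \<le> (LBINT u:{0<..T}. 2 * p u * r u)"
    proof (rule set_integral_mono)
      fix u assume u: "u \<in> {0<..T}"
      then have "u\<^sup>2 \<le> T\<^sup>2" by (intro power_mono) auto
      then have "l * n / 4 * u\<^sup>2 \<le> l * n / 4 * T\<^sup>2" using x by (intro mult_left_mono) auto
      then have m: "?m u = l * n / 4 * u\<^sup>2" using T by simp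
      have "l * n\<^sup>2 / 2 * u^3 = (l * n\<^sup>2 / 2 * u^3) * 1" by simp
      also have "\<dots> \<le> (l * n\<^sup>2 / 2 * u^3) * (hi / lo)"
        using u l b_bounds lo by (intro mult_left_mono) auto
      also have "\<dots> = 2 * p u * (2 * hi * (l * n / 4 * u\<^sup>2))"
        using u lo by (simp add: p_def power2_eq_square power3_eq_cube field_simps)
      also have "\<dots> = 2 * p u * r u" by (simp only: r_def m)
      finally show "l * n\<^sup>2 / 2 * u^3 \<le> 2 * p u * r u" .
    next
      show "set_integrable lborel {0<..T} (\<lambda>u. l * n\<^sup>2 / 2 * u^3)"
        by (intro si continuous_intros)
      show "set_integrable lborel {0<..T} (\<lambda>u. 2 * p u * r u)"
        by (rule si[OF contpr])
    qed
    also have "\<dots> \<le> (LBINT u:{0<..v}. 2 * p u * r u)"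
      unfolding set_lebesgue_integral_def
      using si[OF contpr, of T] si[OF contpr, of v] T p_nonneg r_nonneg
      by (intro integral_mono) (auto simp: set_integrable_def indicator_def)
    finally show ?thesis .
  qed
  finally have 1: "norm (F v) \<le> (LBINT u:{0<..v}. 2 * p u * r u)" .
  have 2: "norm (LBINT u:{0<..v}. R u) \<le> (LBINT u:{0<..v}. (p u)\<^sup>2)"
    unfolding set_lebesgue_integral_def
  proof (rule Bochner_Integration.integral_norm_bound_integral)
    show "integrable lborel (\<lambda>u. indicat_real {0<..v} u *\<^sub>R R u)" using si[OF contR] by (simp add: set_integrable_def)
    show "integrable lborel (\<lambda>u. indicat_real {0<..v} u *\<^sub>R (p u)\<^sup>2)" using si[OF contp] by (simp add: set_integrable_def)
    show "norm (indicat_real {0<..v} u *\<^sub>R R u) \<le> indicat_real {0<..v} u *\<^sub>R (p u)\<^sup>2" for u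
      using \<alpha>_diff[of u] p_nonneg[of u]
      by (auto simp: R_def norm_mult abs_le_square_iff[symmetric] indicator_def simp flip: of_real_add of_real_power)
  qed
  have "norm (LBINT u:{0<..v}. (U u)\<^sup>2) \<le> norm (F v) + norm (LBINT u:{0<..v}. R u)"
    unfolding eq by (rule norm_triangle_ineq)
  also have "\<dots> \<le> (LBINT u:{0<..v}. 2 * p u * r u) + (LBINT u:{0<..v}. (p u)\<^sup>2)" using 1 2 by simp
  also have "\<dots> = (LBINT u:{0<..v}. (p u)\<^sup>2 + 2 * p u * r u)"
    using si[OF contpr] si[OF contp] by (simp add: set_integral_add)
  finally show ?thesis .
qed

end

section \<open>From half lines to the whole line, and duality for the pair of integrals\<close>

lemma integral_eq_half_lines:
  fixes f :: "real \<Rightarrow> 'b::{banach, second_countable_topology}"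
  assumes f: "integrable lborel f"
  shows "(LBINT u. f u) = (LBINT u:{0<..}. f u) + (LBINT u:{0<..}. f (- u))"
proof -
  have [measurable]: "f \<in> borel_measurable borel" using borel_measurable_integrable[OF f] by simp
  have i: "set_integrable lborel A f" if "A \<in> sets borel" for A
    unfolding set_integrable_def by (rule integrable_mult_indicator[OF _ f]) (use that in simp)
  have "(LBINT u. f u) = (LBINT u. indicat_real {0<..} u *\<^sub>R f u + indicat_real {..<0} u *\<^sub>R f u)"
  proof (rule integral_cong_AE)
    show "AE u in lborel. f u = indicat_real {0<..} u *\<^sub>R f u + indicat_real {..<0} u *\<^sub>R f u"
      using AE_lborel_singleton[of 0] by eventually_elim (auto simp: indicator_def)
  qed auto
  also have "\<dots> = (LBINT u:{0<..}. f u) + (LBINT u:{..<0}. f u)"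
    using i[of "{0<..}"] i[of "{..<0}"] by (simp add: set_integrable_def set_lebesgue_integral_def)
  also have "(LBINT u:{..<0}. f u) = (LBINT u:{0<..}. f (- u))"
    unfolding set_lebesgue_integral_def
    by (subst lborel_integral_real_affine[of "- 1" _ 0]) (auto intro!: Bochner_Integration.integral_cong simp: indicator_def)
  finally show ?thesis .
qed

text \<open>The cross product of \<open>c * z\<close> with the conjugate of \<open>d * cnj z\<close>
  contains \<open>z\<^sup>2\<close> and not the squared modulus of \<open>z\<close>. This is where
  the oscillating square enters.\<close>

lemma cmod_comb_cnj_sq:
  "(cmod (c * z + d * cnj z))\<^sup>2
    = ((cmod c)\<^sup>2 + (cmod d)\<^sup>2) * (cmod z)\<^sup>2 + 2 * Re (c * cnj d * z\<^sup>2)"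
proof -
  obtain c1 c2 d1 d2 x y where "c = Complex c1 c2" "d = Complex d1 d2" "z = Complex x y"
    by (metis complex.exhaust)
  then show ?thesis unfolding cmod_power2 power2_eq_square[of z]
    by (simp add: power2_eq_square algebra_simps)
qed

context warped_exponential begin

text \<open>The two copies of \<open>p\<^sup>2\<close> use up the factor \<open>sqrt 2\<close> on
  \<open>p\<close>, and the cross term it creates covers \<open>2 * p u * r u\<close>. The
  coefficient of \<open>r\<close> therefore stays 1, which keeps \<open>sqrt 2\<close> out of the
  frequency-dependent constant.\<close>

lemma quadratic_form_le: "(p u)\<^sup>2 + (r u)\<^sup>2 + ((p u)\<^sup>2 + 2 * p u * r u) \<le> (k u)\<^sup>2"
proof -
  have "1 \<le> sqrt 2" by simp
  then have "2 * (p u * r u) * 1 \<le> 2 * (p u * r u) * sqrt 2"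
    using p_nonneg r_nonneg by (intro mult_left_mono) auto
  then show ?thesis by (simp add: k_def power2_sum power_mult_distrib algebra_simps)
qed

lemma w_k_sq: "w u * (k u)\<^sup>2 = e u * k u"
  by (simp add: w_def power2_eq_square)

lemma ek_int: "integrable lborel (\<lambda>u. e u * k u)"
proof (rule Bochner_Integration.integrable_bound)
  show "integrable lborel (\<lambda>u. sqrt 2 * n / (2 * lo) * (\<bar>u\<bar> * e u) + 2 * hi * e u)"
    using e_int e_int1 by (intro Bochner_Integration.integrable_add integrable_mult_right)
  have "norm (e u * k u) \<le> norm (sqrt 2 * n / (2 * lo) * (\<bar>u\<bar> * e u) + 2 * hi * e u)" for u
  proof -
    have "r u \<le> 2 * hi" using b_bounds by (simp add: r_def)
    then have "e u * r u \<le> e u * (2 * hi)" using e_nonneg by (rule mult_left_mono)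
    then have "e u * k u \<le> sqrt 2 * n / (2 * lo) * (\<bar>u\<bar> * e u) + 2 * hi * e u"
      by (simp add: k_def p_def algebra_simps)
    moreover have "norm (e u * k u) = e u * k u" using e_nonneg k_nonneg by simp
    ultimately show ?thesis unfolding real_norm_def by linarith
  qed
  then show "AE u in lborel. norm (e u * k u) \<le> norm (sqrt 2 * n / (2 * lo) * (\<bar>u\<bar> * e u) + 2 * hi * e u)"
    by (intro AE_I2)
qed simp

text \<open>The weight may blow up like 1 / |u| at 0; a factor dominated by \<open>k\<^sup>2\<close>
  compensates this, since \<open>w * k\<^sup>2 = e * k\<close> is integrable.\<close>

lemma w_bound_int:
  fixes g :: "real \<Rightarrow> 'c::{banach, second_countable_topology}"
  assumes [measurable]: "g \<in> borel_measurable borel" and "\<And>u. norm (g u) \<le> (k u)\<^sup>2"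
  shows "integrable lborel (\<lambda>u. w u *\<^sub>R g u)"
proof (rule Bochner_Integration.integrable_bound[OF ek_int])
  show "AE u in lborel. norm (w u *\<^sub>R g u) \<le> norm (e u * k u)"
    using assms(2) w_nonneg e_nonneg k_nonneg by (auto simp: w_k_sq[symmetric] intro!: mult_left_mono)
qed simp

lemma U_sq_le_k: "norm ((U u)\<^sup>2) \<le> (k u)\<^sup>2"
  using U_sq_le[of u] quadratic_form_le[of u] p_nonneg[of u] r_nonneg[of u]
  by (simp add: norm_power) (smt (verit) mult_nonneg_nonneg zero_le_power2)

lemma wU_int: "integrable lborel (\<lambda>u. w u *\<^sub>R (U u)\<^sup>2)"
  by (rule w_bound_int) (auto simp: U_sq_le_k)

lemma w_eta_int: "integrable lborel (\<lambda>u. w u * ((p u)\<^sup>2 + 2 * p u * r u))"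
  using w_bound_int[of "\<lambda>u. (p u)\<^sup>2 + 2 * p u * r u"] quadratic_form_le p_nonneg r_nonneg
  by simp (smt (verit) mult_nonneg_nonneg zero_le_power2)

text \<open>\<open>w\<close> decreases on the positive half line because \<open>e\<close> decreases
  and \<open>k\<close> increases. Its superlevel sets are bounded because \<open>w u\<close> is at
  most the reciprocal of \<open>sqrt 2 * p u\<close>, which tends to 0.\<close>

lemma half_line_bound:
  "norm (LBINT u:{0<..}. w u *\<^sub>R (U u)\<^sup>2) \<le> (LBINT u:{0<..}. w u * ((p u)\<^sup>2 + 2 * p u * r u))"
proof (rule norm_integral_antimono_weight_le)
  fix u v :: real assume uv: "0 < u" "u \<le> v"
  have sq: "u\<^sup>2 \<le> v\<^sup>2" using uv by (intro power_mono) auto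
  then have "l * n / 4 * u\<^sup>2 \<le> l * n / 4 * v\<^sup>2" using l n by (intro mult_left_mono) auto
  then have "r u \<le> r v" using b_bounds by (auto simp: r_def intro!: mult_left_mono)
  moreover have "p u \<le> p v" using uv n lo by (auto simp: p_def field_simps)
  ultimately have "k u \<le> k v" by (auto simp: k_def intro: add_mono)
  then show "w v \<le> w u"
    using uv e_anti[OF uv] k_pos[of u] e_nonneg by (auto simp: w_def intro!: frac_le)
next
  fix z :: real assume z: "0 < z"
  have "u \<le> 2 * lo / (sqrt 2 * n * z)" if u: "0 < u" "z < w u" for u
  proof -
    have p: "0 < sqrt 2 * p u" using u n lo by (simp add: p_def)
    have "w u \<le> 1 / (sqrt 2 * p u)"
      unfolding w_def using e_le_1 e_nonneg r_nonneg p by (intro frac_le) (auto simp: k_def)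
    then have "z < 1 / (sqrt 2 * p u)" using u by simp
    then have "z * (sqrt 2 * p u) < 1" using p by (simp add: pos_less_divide_eq)
    then show ?thesis using u n lo z by (simp add: p_def field_simps)
  qed
  then show "\<exists>c. \<forall>u>0. z < w u \<longrightarrow> u \<le> c" by blast
next
  show "set_integrable lborel {0<..} (\<lambda>u. w u *\<^sub>R (U u)\<^sup>2)"
    unfolding set_integrable_def by (rule integrable_mult_indicator[OF _ wU_int]) simp
  show "set_integrable lborel {0<..} (\<lambda>u. w u * ((p u)\<^sup>2 + 2 * p u * r u))"
    unfolding set_integrable_def by (rule integrable_mult_indicator[OF _ w_eta_int]) simp
qed (auto intro: w_nonneg integral_U_sq)

text \<open>Time reversal together with a sign change of the phase preserves all the hypotheses, so
  the negative half line needs no separate estimate.\<close>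

lemma reflected: "warped_exponential l b lo hi n (\<lambda>u. \<alpha> (- u)) (\<lambda>u. - \<Gamma> (- u)) e"
proof
  show "continuous_on UNIV (\<lambda>u. \<alpha> (- u))"
    by (rule continuous_on_compose2[OF \<alpha>_cont]) (auto intro: continuous_intros)
  show "((\<lambda>u. - \<Gamma> (- u)) has_real_derivative l * (\<alpha> (- u))\<^sup>2) (at u)" for u
    using DERIV_minus[OF \<Gamma>_deriv[of "- u", unfolded DERIV_mirror]] by simp
  show "\<bar>(\<alpha> (- u))\<^sup>2 - b\<^sup>2\<bar> \<le> n * \<bar>u\<bar>" for u using \<alpha>_lip[of "- u"] by simp
qed (auto simp: l lo n \<alpha>_lo \<alpha>_hi \<alpha>_0 \<Gamma>_0 e_nonneg e_even e_le_1 e_anti e_int e_int1)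

lemma integral_wU_bound:
  "norm (LBINT u. w u *\<^sub>R (U u)\<^sup>2) \<le> (LBINT u. w u * ((p u)\<^sup>2 + 2 * p u * r u))"
proof -
  interpret R: warped_exponential l b lo hi n "\<lambda>u. \<alpha> (- u)" "\<lambda>u. - \<Gamma> (- u)" e by (rule reflected)
  \<comment> \<open>Only \<open>U\<close> depends on \<alpha> and \<Gamma>; \<open>p\<close>,
    \<open>r\<close> and \<open>w\<close> are the same functions in the reflected instance, and
    even. The negative half line thus contributes the conjugate of a positive half-line
    integral.\<close>
  have U: "U (- u) = cnj (R.U u)" for u by (simp add: U_def R.U_def exp_cnj)
  have p: "p (- u) = p u" and r: "r (- u) = r u" for u by (simp_all add: p_def r_def)
  have w: "w (- u) = w u" for u by (simp add: w_def k_def p r e_even)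
  have "(LBINT u:{0<..}. w (- u) *\<^sub>R (U (- u))\<^sup>2) = cnj (LBINT u:{0<..}. w u *\<^sub>R (R.U u)\<^sup>2)"
  proof -
    have "(LBINT u:{0<..}. w (- u) *\<^sub>R (U (- u))\<^sup>2)
        = (LBINT u. cnj (indicat_real {0<..} u *\<^sub>R (w u *\<^sub>R (R.U u)\<^sup>2)))"
      by (simp only: U w complex_cnj_scaleR complex_cnj_power set_lebesgue_integral_def)
    then show ?thesis by (simp only: Bochner_Integration.integral_cnj set_lebesgue_integral_def)
  qed
  then have "norm (LBINT u. w u *\<^sub>R (U u)\<^sup>2)
      \<le> norm (LBINT u:{0<..}. w u *\<^sub>R (U u)\<^sup>2) + norm (LBINT u:{0<..}. w u *\<^sub>R (R.U u)\<^sup>2)"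
    using norm_triangle_ineq[of "LBINT u:{0<..}. w u *\<^sub>R (U u)\<^sup>2"
        "cnj (LBINT u:{0<..}. w u *\<^sub>R (R.U u)\<^sup>2)"]
    unfolding complex_mod_cnj by (subst integral_eq_half_lines[OF wU_int]) (simp only:)
  also have "\<dots> \<le> (LBINT u. w u * ((p u)\<^sup>2 + 2 * p u * r u))"
    using add_mono[OF half_line_bound R.half_line_bound]
    by (subst integral_eq_half_lines[OF w_eta_int]) (simp only: w p r)
  finally show ?thesis .
qed

lemma U_le: "cmod (U u) \<le> 2 * hi"
proof -
  have "cmod (U u) \<le> cmod (of_real (\<alpha> u) * exp (\<i> * of_real (\<Gamma> u))) + cmod (of_real b * exp (\<i> * of_real (l * b\<^sup>2 * u)))"
    unfolding U_def by (rule norm_triangle_ineq4)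
  also have "\<dots> = \<bar>\<alpha> u\<bar> + \<bar>b\<bar>" by (simp only: norm_mult norm_exp_i_times) simp
  finally show ?thesis using \<alpha>_lo[of u] \<alpha>_hi[of u] b_bounds lo by simp
qed

lemma cnj_U_meas [measurable]: "(\<lambda>u. cnj (U u)) \<in> borel_measurable borel"
  by (intro borel_measurable_continuous_onI continuous_intros U_cont)

text \<open>The two integrals are tested against one unit vector of \<open>\<complex>\<^sup>2\<close>; the weight \<open>w = e / k\<close>
  turns the resulting \<open>L\<^sup>1\<close> norm into a quadratic form whose off-diagonal part is
  \<open>integral_wU_bound\<close>.\<close>
lemma pair_bound:
  assumes f [measurable]: "f \<in> borel_measurable borel" and f_le: "\<And>u. cmod (f u) \<le> e u"
  shows "(cmod (LBINT u. U u * f u))\<^sup>2 + (cmod (LBINT u. cnj (U u) * f u))\<^sup>2 \<le> (LBINT u. e u * k u)\<^sup>2"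
proof -
  have int_f: "integrable lborel (\<lambda>u. g u * f u)"
    if [measurable]: "g \<in> borel_measurable borel" and "\<And>u. cmod (g u) \<le> c" for g c
  proof (rule Bochner_Integration.integrable_bound)
    show "integrable lborel (\<lambda>u. c * e u)" using e_int by simp
    show "AE u in lborel. norm (g u * f u) \<le> norm (c * e u)"
      using that(2) f_le e_nonneg
      by (intro AE_I2) (auto simp: norm_mult intro!: order_trans[OF _ abs_ge_self] mult_mono order_trans[OF norm_ge_zero])
  qed simp
  define A where "A = (LBINT u. U u * f u)"
  define B where "B = (LBINT u. cnj (U u) * f u)"
  define s where "s = sqrt ((cmod A)\<^sup>2 + (cmod B)\<^sup>2)"
  have s2: "s\<^sup>2 = (cmod A)\<^sup>2 + (cmod B)\<^sup>2" by (simp add: s_def)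
  have s0: "0 \<le> s" unfolding s_def by (intro real_sqrt_ge_zero add_nonneg_nonneg) simp_all
  have ek: "0 \<le> (LBINT u. e u * k u)" using e_nonneg k_nonneg by simp
  have "s \<le> (LBINT u. e u * k u)"
  proof (cases "s = 0")
    case False
    have s: "0 < s" using False by (simp add: s_def less_le)
    \<comment> \<open>\<open>(c, d)\<close> is the unit vector against which the pair
      \<open>(A, B)\<close> attains its Euclidean norm \<open>s\<close>.\<close>
    define c where "c = cnj A / of_real s"
    define d where "d = cnj B / of_real s"
    define V where "V = (\<lambda>u. c * U u + d * cnj (U u))"
    have [measurable]: "V \<in> borel_measurable borel" unfolding V_def by measurable
    have cd: "(cmod c)\<^sup>2 + (cmod d)\<^sup>2 = 1"
      using s by (simp add: c_def d_def norm_divide power_divide flip: add_divide_distrib s2)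
    \<comment> \<open>For a unit vector the cross coefficient is at most 1, so the off-diagonal form
      enters with weight exactly 1, as assumed in \<open>quadratic_form_le\<close>.\<close>
    have cd2: "2 * (cmod c * cmod d) \<le> 1" using sum_squares_bound[of "cmod c" "cmod d"] cd by simp
    have int1: "integrable lborel (\<lambda>u. U u * f u)" "integrable lborel (\<lambda>u. cnj (U u) * f u)"
      using U_le by (auto intro!: int_f[where c = "2 * hi"])
    have "(LBINT u. V u * f u) = c * A + d * B"
      unfolding V_def A_def B_def using int1 by (simp add: distrib_right mult.assoc)
    also have "\<dots> = of_real s"
    proof -
      have "cnj A * A + cnj B * B = of_real (s\<^sup>2)"
        unfolding s2 of_real_add complex_norm_square by (simp add: mult.commute)
      then show ?thesis using s by (simp add: c_def d_def power2_eq_square field_simps)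
    qed
    finally have "s = norm (LBINT u. V u * f u)" using s by simp
    have Vsq: "(cmod (V u))\<^sup>2 = (cmod (U u))\<^sup>2 + 2 * Re (c * cnj d * (U u)\<^sup>2)" for u
      unfolding V_def cmod_comb_cnj_sq by (simp add: cd)
    have wUn: "integrable lborel (\<lambda>u. w u * (cmod (U u))\<^sup>2)"
      using w_bound_int[of "\<lambda>u. (cmod (U u))\<^sup>2"] U_sq_le_k by (simp add: norm_power)
    have wVeq: "w u * (cmod (V u))\<^sup>2 = w u * (cmod (U u))\<^sup>2 + 2 * Re (c * cnj d * (w u *\<^sub>R (U u)\<^sup>2))" for u
      unfolding Vsq by (simp add: scaleR_conv_of_real algebra_simps)
    have wRe: "integrable lborel (\<lambda>u. 2 * Re (c * cnj d * (w u *\<^sub>R (U u)\<^sup>2)))"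
      using wU_int by (intro integrable_mult_right integrable_Re)
    have wV: "integrable lborel (\<lambda>u. w u * (cmod (V u))\<^sup>2)"
      unfolding wVeq by (intro Bochner_Integration.integrable_add wUn wRe)
    have V_int: "(LBINT u. w u * (cmod (V u))\<^sup>2)
        = (LBINT u. w u * (cmod (U u))\<^sup>2) + 2 * Re (c * cnj d * (LBINT u. w u *\<^sub>R (U u)\<^sup>2))"
    proof -
      have "(LBINT u. Re (c * cnj d * (w u *\<^sub>R (U u)\<^sup>2))) = Re (c * cnj d * (LBINT u. w u *\<^sub>R (U u)\<^sup>2))"
        unfolding integral_Re[OF integrable_mult_right[OF wU_int]] integral_mult_right_zero ..
      then show ?thesis unfolding wVeq using wUn wRe by simp
    qed
    have "2 * Re (c * cnj d * (LBINT u. w u *\<^sub>R (U u)\<^sup>2))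
        \<le> 2 * (cmod c * cmod d) * norm (LBINT u. w u *\<^sub>R (U u)\<^sup>2)"
      using complex_Re_le_cmod[of "c * cnj d * (LBINT u. w u *\<^sub>R (U u)\<^sup>2)"]
      unfolding norm_mult complex_mod_cnj by linarith
    also have "\<dots> \<le> 1 * (LBINT u. w u * ((p u)\<^sup>2 + 2 * p u * r u))"
      by (rule mult_mono[OF cd2 integral_wU_bound]) simp_all
    finally have cross: "2 * Re (c * cnj d * (LBINT u. w u *\<^sub>R (U u)\<^sup>2))
        \<le> 1 * (LBINT u. w u * ((p u)\<^sup>2 + 2 * p u * r u))" .
    have "(LBINT u. w u * (cmod (U u))\<^sup>2) + 1 * (LBINT u. w u * ((p u)\<^sup>2 + 2 * p u * r u))
        = (LBINT u. w u * ((cmod (U u))\<^sup>2 + ((p u)\<^sup>2 + 2 * p u * r u)))"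
      using wUn w_eta_int by (simp add: distrib_left)
    also have "\<dots> \<le> (LBINT u. e u * k u)"
    proof (rule integral_mono)
      show "integrable lborel (\<lambda>u. w u * ((cmod (U u))\<^sup>2 + ((p u)\<^sup>2 + 2 * p u * r u)))"
        using Bochner_Integration.integrable_add[OF wUn w_eta_int] by (simp add: distrib_left)
      show "w u * ((cmod (U u))\<^sup>2 + ((p u)\<^sup>2 + 2 * p u * r u)) \<le> e u * k u" for u
        unfolding w_k_sq[symmetric] using U_sq_le[of u] quadratic_form_le[of u] w_nonneg by (intro mult_left_mono) auto
    qed (rule ek_int)
    finally have Vle: "(LBINT u. w u * (cmod (V u))\<^sup>2) \<le> (LBINT u. e u * k u)"
      using cross V_int by linarith
    \<comment> \<open>Cauchy-Schwarz is used in the pointwise form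
      \<open>2 * k * |V| \<le> k\<^sup>2 + |V|\<^sup>2\<close>. Both halves of the resulting average
      are at most the integral of \<open>e * k\<close>, so the average is too. The point 0, where
      \<open>k\<close> vanishes, is handled by \<open>V 0 = 0\<close>.\<close>
    have "s \<le> (LBINT u. (e u * k u + w u * (cmod (V u))\<^sup>2) / 2)"
      unfolding \<open>s = norm (LBINT u. V u * f u)\<close>
    proof (rule Bochner_Integration.integral_norm_bound_integral)
      show "integrable lborel (\<lambda>u. V u * f u)"
        unfolding V_def using int1 by (simp add: distrib_right mult.assoc)
      show "integrable lborel (\<lambda>u. (e u * k u + w u * (cmod (V u))\<^sup>2) / 2)" using ek_int wV by simp
      show "norm (V u * f u) \<le> (e u * k u + w u * (cmod (V u))\<^sup>2) / 2" for u
      proof (cases "u = 0")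
        case True
        then show ?thesis using e_nonneg k_nonneg w_nonneg by (simp add: V_def U_def \<alpha>_0 \<Gamma>_0)
      next
        case False
        note k = k_pos[OF False]
        have "norm (V u * f u) \<le> cmod (V u) * e u" using f_le by (simp add: norm_mult mult_left_mono)
        also have "\<dots> = e u * (2 * k u * cmod (V u)) / (2 * k u)" using k by simp
        also have "\<dots> \<le> e u * ((k u)\<^sup>2 + (cmod (V u))\<^sup>2) / (2 * k u)"
          using k e_nonneg sum_squares_bound[of "k u" "cmod (V u)"] by (intro divide_right_mono mult_left_mono) auto
        also have "\<dots> = (e u * k u + w u * (cmod (V u))\<^sup>2) / 2"
          using k by (simp add: w_def field_simps power2_eq_square)
        finally show ?thesis .
      qed
    qed
    also have "\<dots> = ((LBINT u. e u * k u) + (LBINT u. w u * (cmod (V u))\<^sup>2)) / 2"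
      using ek_int wV by simp
    finally show ?thesis using Vle by simp
  qed (use ek in simp)
  then have "s\<^sup>2 \<le> (LBINT u. e u * k u)\<^sup>2" using s0 by (rule power_mono)
  then show ?thesis by (simp add: s2 A_def B_def)
qed

end

subsection \<open>Moments of the envelope\<close>

lemma has_bochner_integral_powr_tail:
  assumes "1 < s" "0 < T"
  shows "has_bochner_integral lborel (\<lambda>u. indicat_real {T..} u * u powr (- s)) (T powr (1 - s) / (s - 1))"
proof (rule has_bochner_integral_nn_integral)
  have lim: "((\<lambda>u. u powr (1 - s)) \<longlongrightarrow> 0) at_top"
    using assms tendsto_neg_powr[of "1 - s" "\<lambda>u. u" at_top] by (simp add: filterlim_ident)
  have "(\<integral>\<^sup>+ u. ennreal (u powr (- s)) * indicator {T..} u \<partial>lborel) = 0 - (- (T powr (1 - s) / (s - 1)))"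
  proof (rule nn_integral_FTC_atLeast[where F = "\<lambda>u. - (u powr (1 - s) / (s - 1))"])
    show "((\<lambda>u. - (u powr (1 - s) / (s - 1))) has_real_derivative u powr (- s)) (at u)" if "T \<le> u" for u
    proof -
      have "((\<lambda>u. u powr (1 - s)) has_real_derivative (1 - s) * u powr (1 - s - 1)) (at u)"
        using that assms by (intro has_real_derivative_powr) auto
      from DERIV_minus[OF DERIV_cdivide[OF this, of "s - 1"]]
      have "((\<lambda>u. - (u powr (1 - s) / (s - 1))) has_real_derivative ((s - 1) * u powr (1 - s - 1)) / (s - 1)) (at u)"
        by (simp only: minus_divide_left minus_mult_left minus_diff_eq)
      then show ?thesis using assms by simp
    qed
    show "((\<lambda>u. - (u powr (1 - s) / (s - 1))) \<longlongrightarrow> 0) at_top"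
      using tendsto_minus[OF tendsto_divide[OF lim tendsto_const[of "s - 1"]]] assms by simp
  qed auto
  also have "(\<integral>\<^sup>+ u. ennreal (u powr (- s)) * indicator {T..} u \<partial>lborel)
      = (\<integral>\<^sup>+ u. ennreal (indicat_real {T..} u * u powr (- s)) \<partial>lborel)"
    by (intro nn_integral_cong) (auto simp: indicator_def)
  finally show "(\<integral>\<^sup>+ u. ennreal (indicat_real {T..} u * u powr (- s)) \<partial>lborel) = ennreal (T powr (1 - s) / (s - 1))"
    by simp
qed (use assms in auto)

text \<open>The dominating function is a power on [-T, T] and the tail \<open>|u| powr (- s)\<close>
  outside. It is assembled as \<open>h u + h (- u)\<close> from a function \<open>h\<close> living
  on the positive half line, whence the factor 2; the overlap at \<open>T\<close> only enlarges
  it.\<close>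

lemma power_dominated_integral:
  fixes g :: "real \<Rightarrow> real" and k :: nat
  assumes g [measurable]: "g \<in> borel_measurable borel" and g_nonneg: "\<And>u. 0 \<le> g u"
    and s: "1 < s" and T: "0 < T" and A: "0 \<le> A"
    and near: "\<And>u. \<bar>u\<bar> \<le> T \<Longrightarrow> g u \<le> A * \<bar>u\<bar> ^ k"
    and far: "\<And>u. T \<le> \<bar>u\<bar> \<Longrightarrow> g u \<le> \<bar>u\<bar> powr (- s)"
  shows "integrable lborel g"
    and "(LBINT u. g u) \<le> 2 * (A * T ^ (k + 1) / (k + 1) + T powr (1 - s) / (s - 1))"
proof -
  define h where "h = (\<lambda>u. A * u ^ k * indicat_real {0..T} u + indicat_real {T..} u * u powr (- s))"
  have h: "has_bochner_integral lborel h (A * T ^ (k + 1) / (k + 1) + T powr (1 - s) / (s - 1))"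
    unfolding h_def
  proof (rule has_bochner_integral_add[OF _ has_bochner_integral_powr_tail[OF s T]])
    have "has_bochner_integral lborel (\<lambda>u. A * u ^ k * indicat_real {0..T} u)
        (A * T ^ (k + 1) / (k + 1) - A * 0 ^ (k + 1) / (k + 1))"
    proof (rule has_bochner_integral_FTC_Icc_real)
      show "((\<lambda>u. A * u ^ (k + 1) / real (k + 1)) has_real_derivative A * u ^ k) (at u)" for u
        using DERIV_cdivide[OF DERIV_cmult[OF DERIV_pow[of "Suc k" u]], of A "real (Suc k)"]
        by (simp del: of_nat_Suc)
    qed (use T in \<open>auto intro!: continuous_intros\<close>)
    then show "has_bochner_integral lborel (\<lambda>u. A * u ^ k * indicat_real {0..T} u) (A * T ^ (k + 1) / (k + 1))"
      by simp
  qed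
  have h_neg: "has_bochner_integral lborel (\<lambda>u. h (- u)) (A * T ^ (k + 1) / (k + 1) + T powr (1 - s) / (s - 1))"
    using lborel_has_bochner_integral_real_affine_iff[of "- 1" h _ 0] h by simp
  have dom: "has_bochner_integral lborel (\<lambda>u. h u + h (- u)) (2 * (A * T ^ (k + 1) / (k + 1) + T powr (1 - s) / (s - 1)))"
    using has_bochner_integral_add[OF h h_neg] by simp
  have dom_int: "integrable lborel (\<lambda>u. h u + h (- u))"
    using dom by (simp add: has_bochner_integral_iff)
  have le: "g u \<le> h u + h (- u)" for u
  proof -
    have "0 \<le> h v" for v using A by (auto simp: h_def indicator_def)
    moreover have "g u \<le> h \<bar>u\<bar>"
      using near[of u] far[of u] A by (cases "\<bar>u\<bar> \<le> T") (auto simp: h_def indicator_def intro: order_trans)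
    ultimately show ?thesis by (cases "0 \<le> u") (auto intro: order_trans add_increasing add_increasing2)
  qed
  show int: "integrable lborel g"
    by (rule Bochner_Integration.integrable_bound[OF dom_int])
      (use g_nonneg le in \<open>auto intro!: AE_I2 order_trans[OF le]\<close>)
  have "(LBINT u. g u) \<le> (LBINT u. h u + h (- u))"
    using int dom_int le by (rule integral_mono)
  then show "(LBINT u. g u) \<le> 2 * (A * T ^ (k + 1) / (k + 1) + T powr (1 - s) / (s - 1))"
    using has_bochner_integral_integral_eq[OF dom] by simp
qed

text \<open>The decay hypothesis on the wavelet as a function. Since
  \<open>0 powr \<beta> = 0\<close>, its value at 0 is 1.\<close>

definition envelope :: "real \<Rightarrow> real \<Rightarrow> real" where
  "envelope \<beta> u = 1 / (1 + \<bar>u\<bar> powr \<beta>)"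

lemma envelope_meas [measurable]: "envelope \<beta> \<in> borel_measurable borel"
  unfolding envelope_def[abs_def] by measurable

lemma envelope_pos: "0 < envelope \<beta> u"
  by (simp add: envelope_def add_pos_nonneg)

lemma envelope_le_1: "envelope \<beta> u \<le> 1"
  by (simp add: envelope_def divide_le_eq_1 add_pos_nonneg)

lemma envelope_le_powr: "u \<noteq> 0 \<Longrightarrow> envelope \<beta> u \<le> \<bar>u\<bar> powr (- \<beta>)"
  by (auto simp: envelope_def powr_minus_divide intro!: divide_left_mono mult_pos_pos add_pos_nonneg)

lemma envelope_even: "envelope \<beta> (- u) = envelope \<beta> u"
  by (simp add: envelope_def)

lemma envelope_anti: "0 \<le> \<beta> \<Longrightarrow> 0 < u \<Longrightarrow> u \<le> v \<Longrightarrow> envelope \<beta> v \<le> envelope \<beta> u"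
  by (auto simp: envelope_def intro!: divide_left_mono add_left_mono powr_mono2 mult_pos_pos add_pos_nonneg)

lemma envelope_integrable: "1 < \<beta> \<Longrightarrow> integrable lborel (envelope \<beta>)"
  by (rule power_dominated_integral(1)[where T = 1 and A = 1 and k = 0 and s = \<beta>])
    (auto simp: envelope_pos less_imp_le envelope_le_1 intro!: envelope_le_powr)

text \<open>Splitting at 1 gives 2 (1/2 + 1/(\<beta> - 2)), which is \<beta>/(\<beta> - 2).\<close>

lemma envelope_moment:
  assumes "2 < \<beta>"
  shows "integrable lborel (\<lambda>u. \<bar>u\<bar> * envelope \<beta> u)"
    and "(LBINT u. \<bar>u\<bar> * envelope \<beta> u) \<le> \<beta> / (\<beta> - 2)"
proof -
  have near: "\<bar>u\<bar> * envelope \<beta> u \<le> 1 * \<bar>u\<bar> ^ 1" for u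
    using mult_left_mono[OF envelope_le_1[of \<beta> u], of "\<bar>u\<bar>"] by simp
  have far: "\<bar>u\<bar> * envelope \<beta> u \<le> \<bar>u\<bar> powr (- (\<beta> - 1))" if "1 \<le> \<bar>u\<bar>" for u
  proof -
    have "\<bar>u\<bar> * envelope \<beta> u \<le> \<bar>u\<bar> * \<bar>u\<bar> powr (- \<beta>)"
      using that by (intro mult_left_mono envelope_le_powr) auto
    also have "\<dots> = \<bar>u\<bar> powr (1 + (- \<beta>))" using that by (subst powr_add) auto
    finally show ?thesis by simp
  qed
  note * = power_dominated_integral[where g = "\<lambda>u. \<bar>u\<bar> * envelope \<beta> u" and T = 1 and A = 1 and k = 1 and s = "\<beta> - 1"]
  show "integrable lborel (\<lambda>u. \<bar>u\<bar> * envelope \<beta> u)"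
    by (rule *(1)) (use assms near far in \<open>auto simp: envelope_pos less_imp_le\<close>)
  have "(LBINT u. \<bar>u\<bar> * envelope \<beta> u) \<le> 2 * (1 * 1 ^ (1 + 1) / real (1 + 1) + 1 powr (1 - (\<beta> - 1)) / (\<beta> - 1 - 1))"
    by (rule *(2)) (use assms near far in \<open>auto simp: envelope_pos less_imp_le\<close>)
  also have "\<dots> = \<beta> / (\<beta> - 2)" using assms by (simp add: field_simps)
  finally show "(LBINT u. \<bar>u\<bar> * envelope \<beta> u) \<le> \<beta> / (\<beta> - 2)" .
qed

text \<open>Split at the point where the two majorants \<open>x * u\<^sup>2\<close> and
  \<open>|u| powr (- \<beta>)\<close> cross, and not where the minimum saturates. Then the near and
  far parts are both multiples of \<open>x powr \<rho>\<close>, with coefficients 1/3 and 1/(\<beta>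
  - 1), whose sum is 1/(3 \<rho>).\<close>

lemma envelope_truncated_moment:
  assumes \<beta>: "2 < \<beta>" and x: "0 \<le> x"
  defines "\<rho> \<equiv> (\<beta> - 1) / (\<beta> + 2)"
  shows "integrable lborel (\<lambda>u. min (x * u\<^sup>2) 1 * envelope \<beta> u)"
    and "(LBINT u. min (x * u\<^sup>2) 1 * envelope \<beta> u) \<le> 2 / (3 * \<rho>) * x powr \<rho>"
proof -
  show int: "integrable lborel (\<lambda>u. min (x * u\<^sup>2) 1 * envelope \<beta> u)"
    by (rule Bochner_Integration.integrable_bound[OF envelope_integrable[of \<beta>]])
      (use \<beta> x envelope_pos[of \<beta>] in \<open>auto simp: abs_mult less_imp_le mult_le_cancel_right1\<close>)
  show "(LBINT u. min (x * u\<^sup>2) 1 * envelope \<beta> u) \<le> 2 / (3 * \<rho>) * x powr \<rho>"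
  proof (cases "x = 0")
    case False
    then have x: "0 < x" using x by simp
    define T where "T = x powr (- 1 / (\<beta> + 2))"
    have T: "0 < T" using x by (simp add: T_def)
    have near: "min (x * u\<^sup>2) 1 * envelope \<beta> u \<le> x * \<bar>u\<bar> ^ 2" for u
    proof -
      have "min (x * u\<^sup>2) 1 * envelope \<beta> u \<le> (x * u\<^sup>2) * 1"
        using x envelope_pos[of \<beta> u] envelope_le_1 by (intro mult_mono) auto
      then show ?thesis by simp
    qed
    have far: "min (x * u\<^sup>2) 1 * envelope \<beta> u \<le> \<bar>u\<bar> powr (- \<beta>)" if "T \<le> \<bar>u\<bar>" for u
    proof -
      have "min (x * u\<^sup>2) 1 * envelope \<beta> u \<le> 1 * \<bar>u\<bar> powr (- \<beta>)"
        using x envelope_pos[of \<beta> u] T that by (intro mult_mono envelope_le_powr) auto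
      then show ?thesis by simp
    qed
    have 1: "x * T ^ (2 + 1) = x powr \<rho>"
    proof -
      have "x * T ^ (2 + 1) = x powr 1 * T powr 3" using T x by simp
      also have "\<dots> = x powr (1 + (- 1 / (\<beta> + 2)) * 3)" by (simp only: T_def powr_powr powr_add)
      also have "1 + (- 1 / (\<beta> + 2)) * 3 = \<rho>" using \<beta> by (simp add: \<rho>_def field_simps)
      finally show ?thesis .
    qed
    have 2: "T powr (1 - \<beta>) = x powr \<rho>"
    proof -
      have "T powr (1 - \<beta>) = x powr ((- 1 / (\<beta> + 2)) * (1 - \<beta>))" by (simp only: T_def powr_powr)
      also have "(- 1 / (\<beta> + 2)) * (1 - \<beta>) = \<rho>" using \<beta> by (simp add: \<rho>_def field_simps)
      finally show ?thesis .
    qed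
    have "(LBINT u. min (x * u\<^sup>2) 1 * envelope \<beta> u)
        \<le> 2 * (x * T ^ (2 + 1) / real (2 + 1) + T powr (1 - \<beta>) / (\<beta> - 1))"
      by (rule power_dominated_integral(2)) (use x \<beta> T near far envelope_pos in \<open>auto simp: less_imp_le\<close>)
    also have "\<dots> = 2 / (3 * \<rho>) * x powr \<rho>"
      unfolding 1 2 using \<beta> by (simp add: \<rho>_def field_simps)
    finally show ?thesis .
  qed simp
qed

subsection \<open>The bound at a single frequency\<close>

text \<open>\<open>pair_bound\<close> with the two envelope moments inserted. The locale needs
  \<open>n > 0\<close> to have \<open>k\<close> positive off 0; for \<open>n = 0\<close> the
  amplitude is constant, the phase is linear and \<open>H\<close> vanishes identically.\<close>

lemma unit_amplitude_bound:
  fixes \<alpha> \<Gamma> :: "real \<Rightarrow> real" and f :: "real \<Rightarrow> complex" and b l :: real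
  assumes \<beta>: "2 < \<beta>" and l: "0 < l" and lo: "0 < lo" and n: "0 \<le> n"
    and \<alpha>_cont: "continuous_on UNIV \<alpha>"
    and \<alpha>_lo: "\<And>u. lo \<le> \<alpha> u" and \<alpha>_hi: "\<And>u. \<alpha> u \<le> hi" and \<alpha>_0: "\<alpha> 0 = b"
    and \<alpha>_lip: "\<And>u. \<bar>(\<alpha> u)\<^sup>2 - b\<^sup>2\<bar> \<le> n * \<bar>u\<bar>"
    and \<Gamma>_0: "\<Gamma> 0 = 0" and \<Gamma>_deriv: "\<And>u. (\<Gamma> has_real_derivative l * (\<alpha> u)\<^sup>2) (at u)"
    and f [measurable]: "f \<in> borel_measurable borel" and f_le: "\<And>u. cmod (f u) \<le> envelope \<beta> u"
  defines "\<rho> \<equiv> (\<beta> - 1) / (\<beta> + 2)"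
    and "H \<equiv> \<lambda>u. of_real (\<alpha> u) * exp (\<i> * of_real (\<Gamma> u)) - of_real b * exp (\<i> * of_real (l * b\<^sup>2 * u))"
  shows "(cmod (LBINT u. H u * f u))\<^sup>2 + (cmod (LBINT u. cnj (H u) * f u))\<^sup>2
    \<le> (sqrt 2 * (n / (2 * lo)) * (\<beta> / (\<beta> - 2)) + hi * (4 / (3 * \<rho>) * (l * n / 4) powr \<rho>))\<^sup>2"
proof (cases "n = 0")
  case True
  have "\<alpha> u = b" for u
  proof -
    have "(\<alpha> u)\<^sup>2 = b\<^sup>2" using \<alpha>_lip[of u] True by simp
    then show ?thesis using \<alpha>_lo[of u] \<alpha>_lo[of 0] \<alpha>_0 lo by (simp add: power2_eq_iff_nonneg)
  qed
  note \<alpha>_b = this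
  have "\<bar>\<Gamma> u - l * b\<^sup>2 * u\<bar> \<le> 0 * u\<^sup>2 / 2" for u
    by (rule quadratic_bound_of_deriv_bound[where f' = "\<lambda>u. 0"])
      (use \<Gamma>_0 \<Gamma>_deriv in \<open>auto intro!: derivative_eq_intros simp: \<alpha>_b\<close>)
  then have "H u = 0" for u by (simp add: H_def \<alpha>_b)
  then show ?thesis by simp
next
  case False
  interpret warped_exponential l b lo hi n \<alpha> \<Gamma> "envelope \<beta>"
    by unfold_locales (use assms False envelope_pos in
      \<open>auto simp: less_imp_le envelope_even envelope_le_1 intro!: envelope_anti envelope_integrable envelope_moment(1)\<close>)
  have ek: "envelope \<beta> u * k u = sqrt 2 * (n / (2 * lo)) * (\<bar>u\<bar> * envelope \<beta> u)
      + 2 * hi * (min (l * n / 4 * u\<^sup>2) 1 * envelope \<beta> u)" for u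
    by (simp add: k_def p_def r_def algebra_simps)
  have x: "0 \<le> l * n / 4" using l n by simp
  have "(LBINT u. envelope \<beta> u * k u)
      = sqrt 2 * (n / (2 * lo)) * (LBINT u. \<bar>u\<bar> * envelope \<beta> u)
        + 2 * hi * (LBINT u. min (l * n / 4 * u\<^sup>2) 1 * envelope \<beta> u)"
    unfolding ek using envelope_moment(1)[OF \<beta>] envelope_truncated_moment(1)[OF \<beta> x] by simp
  also have "\<dots> \<le> sqrt 2 * (n / (2 * lo)) * (\<beta> / (\<beta> - 2)) + 2 * hi * (2 / (3 * \<rho>) * (l * n / 4) powr \<rho>)"
    unfolding \<rho>_def using n lo b_bounds
    by (intro add_mono mult_left_mono envelope_moment(2)[OF \<beta>] envelope_truncated_moment(2)[OF \<beta> x]) auto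
  finally have "(LBINT u. envelope \<beta> u * k u)
      \<le> sqrt 2 * (n / (2 * lo)) * (\<beta> / (\<beta> - 2)) + hi * (4 / (3 * \<rho>) * (l * n / 4) powr \<rho>)" by simp
  moreover have "0 \<le> (LBINT u. envelope \<beta> u * k u)" using k_nonneg e_nonneg by simp
  ultimately have "(LBINT u. envelope \<beta> u * k u)\<^sup>2
      \<le> (sqrt 2 * (n / (2 * lo)) * (\<beta> / (\<beta> - 2)) + hi * (4 / (3 * \<rho>) * (l * n / 4) powr \<rho>))\<^sup>2"
    by (rule power_mono)
  moreover have "H = U" by (simp add: H_def U_def fun_eq_iff)
  ultimately show ?thesis using pair_bound[OF f f_le] by simp
qed

lemma integral_envelope_bound:
  fixes g f :: "real \<Rightarrow> complex"
  assumes \<beta>: "2 < \<beta>" and [measurable]: "g \<in> borel_measurable borel" "f \<in> borel_measurable borel"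
    and f_le: "\<And>u. cmod (f u) \<le> envelope \<beta> u" and g_le: "\<And>u. cmod (g u) \<le> c * \<bar>u\<bar>"
  shows "cmod (LBINT u. g u * f u) \<le> c * (\<beta> / (\<beta> - 2))"
proof -
  have c: "0 \<le> c" using order_trans[OF norm_ge_zero g_le[of 1]] by simp
  have le: "norm (g u * f u) \<le> c * (\<bar>u\<bar> * envelope \<beta> u)" for u
    using mult_mono[OF g_le[of u] f_le[of u]] c by (simp add: norm_mult mult.assoc)
  have "cmod (LBINT u. g u * f u) \<le> (LBINT u. c * (\<bar>u\<bar> * envelope \<beta> u))"
  proof (rule Bochner_Integration.integral_norm_bound_integral)
    show "integrable lborel (\<lambda>u. g u * f u)"
      by (rule Bochner_Integration.integrable_bound[OF integrable_mult_right[OF envelope_moment(1)[OF \<beta>], of c]])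
        (use le in \<open>auto intro!: AE_I2 intro: order_trans[OF _ abs_ge_self]\<close>)
  qed (use envelope_moment(1)[OF \<beta>] le in auto)
  also have "\<dots> \<le> c * (\<beta> / (\<beta> - 2))"
    using mult_left_mono[OF envelope_moment(2)[OF \<beta>] c] by simp
  finally show ?thesis .
qed

text \<open>The amplitude \<open>a\<close> is frozen at 0 at the price of \<open>R\<close>, which
  needs no oscillation: each of its two integrals is at most the same constant, so the pair has norm
  at most \<open>sqrt 2\<close> times it. This joins the term that already carries
  \<open>sqrt 2\<close>.\<close>

lemma frequency_bound:
  fixes a \<alpha> \<Gamma> :: "real \<Rightarrow> real" and f :: "real \<Rightarrow> complex" and b l :: real
  assumes \<beta>: "2 < \<beta>" and l: "0 < l" and lo: "0 < lo" and n: "0 \<le> n"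
    and \<alpha>_cont: "continuous_on UNIV \<alpha>"
    and \<alpha>_lo: "\<And>u. lo \<le> \<alpha> u" and \<alpha>_hi: "\<And>u. \<alpha> u \<le> hi" and \<alpha>_0: "\<alpha> 0 = b"
    and \<alpha>_lip: "\<And>u. \<bar>(\<alpha> u)\<^sup>2 - b\<^sup>2\<bar> \<le> n * \<bar>u\<bar>"
    and \<Gamma>_0: "\<Gamma> 0 = 0" and \<Gamma>_deriv: "\<And>u. (\<Gamma> has_real_derivative l * (\<alpha> u)\<^sup>2) (at u)"
    and a_cont: "continuous_on UNIV a" and a_lip: "\<And>u. \<bar>a u - a 0\<bar> \<le> n' * \<bar>u\<bar>"
    and f [measurable]: "f \<in> borel_measurable borel" and f_le: "\<And>u. cmod (f u) \<le> envelope \<beta> u"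
  defines "\<rho> \<equiv> (\<beta> - 1) / (\<beta> + 2)"
    and "G \<equiv> \<lambda>u. of_real (a u * \<alpha> u) * exp (\<i> * of_real (\<Gamma> u)) - of_real (a 0 * b) * exp (\<i> * of_real (l * b\<^sup>2 * u))"
  shows "(cmod (LBINT u. G u * f u))\<^sup>2 + (cmod (LBINT u. cnj (G u) * f u))\<^sup>2
    \<le> (sqrt 2 * (n' * hi + \<bar>a 0\<bar> * (n / (2 * lo))) * (\<beta> / (\<beta> - 2))
        + \<bar>a 0\<bar> * hi * (4 / (3 * \<rho>) * (l * n / 4) powr \<rho>))\<^sup>2"
proof -
  define H where "H = (\<lambda>u. of_real (\<alpha> u) * exp (\<i> * of_real (\<Gamma> u)) - of_real b * exp (\<i> * of_real (l * b\<^sup>2 * u)))"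
  define R where "R = (\<lambda>u. of_real ((a u - a 0) * \<alpha> u) * exp (\<i> * of_real (\<Gamma> u)))"
  have \<Gamma>_cont: "continuous_on UNIV \<Gamma>"
    using \<Gamma>_deriv by (meson DERIV_isCont continuous_at_imp_continuous_on)
  have contH: "continuous_on UNIV H" and contR: "continuous_on UNIV R"
    unfolding H_def R_def by (intro continuous_intros \<alpha>_cont \<Gamma>_cont a_cont)+
  have [measurable]: "H \<in> borel_measurable borel" "R \<in> borel_measurable borel"
      "(\<lambda>u. cnj (H u)) \<in> borel_measurable borel" "(\<lambda>u. cnj (R u)) \<in> borel_measurable borel"
    by (intro borel_measurable_continuous_onI continuous_intros contH contR)+
  have hi: "0 < hi" using lo \<alpha>_lo[of 0] \<alpha>_hi[of 0] by simp
  have n': "0 \<le> n'" using a_lip[of 1] by simp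
  have R_le: "cmod (R u) \<le> (n' * hi) * \<bar>u\<bar>" for u
  proof -
    have "cmod (R u) = \<bar>a u - a 0\<bar> * \<alpha> u"
      using \<alpha>_lo[of u] lo unfolding R_def norm_mult norm_exp_i_times norm_of_real by (simp add: abs_mult)
    also have "\<dots> \<le> (n' * \<bar>u\<bar>) * hi"
      using a_lip[of u] \<alpha>_lo[of u] \<alpha>_hi[of u] lo n' by (intro mult_mono) auto
    finally show ?thesis by (simp add: mult_ac)
  qed
  have H_le: "cmod (H u) \<le> 2 * hi" for u
  proof -
    have "cmod (H u) \<le> cmod (of_real (\<alpha> u) * exp (\<i> * of_real (\<Gamma> u))) + cmod (of_real b * exp (\<i> * of_real (l * b\<^sup>2 * u)))"
      unfolding H_def by (rule norm_triangle_ineq4)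
    also have "\<dots> = \<bar>\<alpha> u\<bar> + \<bar>b\<bar>" by (simp only: norm_mult norm_exp_i_times) simp
    finally show ?thesis using \<alpha>_lo[of u] \<alpha>_hi[of u] \<alpha>_lo[of 0] \<alpha>_hi[of 0] \<alpha>_0 lo by simp
  qed
  have int_H: "integrable lborel (\<lambda>u. g u * f u)"
    if [measurable]: "g \<in> borel_measurable borel" and g: "\<And>u. cmod (g u) \<le> 2 * hi" for g
  proof (rule Bochner_Integration.integrable_bound)
    show "integrable lborel (\<lambda>u. 2 * hi * envelope \<beta> u)" using envelope_integrable[of \<beta>] \<beta> by simp
    show "AE u in lborel. norm (g u * f u) \<le> norm (2 * hi * envelope \<beta> u)"
      using mult_mono[OF g f_le] hi envelope_pos[of \<beta>]
      by (intro AE_I2) (auto simp: norm_mult intro!: order_trans[OF _ abs_ge_self])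
  qed simp
  have int_R: "integrable lborel (\<lambda>u. g u * f u)"
    if [measurable]: "g \<in> borel_measurable borel" and g: "\<And>u. cmod (g u) \<le> (n' * hi) * \<bar>u\<bar>" for g
  proof (rule Bochner_Integration.integrable_bound)
    show "integrable lborel (\<lambda>u. (n' * hi) * (\<bar>u\<bar> * envelope \<beta> u))" using envelope_moment(1)[OF \<beta>] by simp
    show "AE u in lborel. norm (g u * f u) \<le> norm ((n' * hi) * (\<bar>u\<bar> * envelope \<beta> u))"
      using mult_mono[OF g f_le] hi n' envelope_pos[of \<beta>]
      by (intro AE_I2) (auto simp: norm_mult mult.assoc intro!: order_trans[OF _ abs_ge_self])
  qed simp
  have G: "G u = R u + of_real (a 0) * H u" for u
    by (simp add: G_def R_def H_def algebra_simps)
  have "(LBINT u. G u * f u) = (LBINT u. R u * f u) + of_real (a 0) * (LBINT u. H u * f u)"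
    unfolding G using int_H[of H] H_le int_R[of R] R_le by (simp add: distrib_right mult.assoc)
  then have 1: "cmod (LBINT u. G u * f u) \<le> cmod (LBINT u. R u * f u) + \<bar>a 0\<bar> * cmod (LBINT u. H u * f u)"
    by (metis norm_triangle_ineq norm_mult norm_of_real)
  have "(LBINT u. cnj (G u) * f u) = (LBINT u. cnj (R u) * f u) + of_real (a 0) * (LBINT u. cnj (H u) * f u)"
    unfolding G using int_H[of "\<lambda>u. cnj (H u)"] H_le int_R[of "\<lambda>u. cnj (R u)"] R_le
    by (simp add: distrib_right mult.assoc)
  then have 2: "cmod (LBINT u. cnj (G u) * f u) \<le> cmod (LBINT u. cnj (R u) * f u) + \<bar>a 0\<bar> * cmod (LBINT u. cnj (H u) * f u)"
    by (metis norm_triangle_ineq norm_mult norm_of_real)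
  let ?k = "n' * hi * (\<beta> / (\<beta> - 2))"
  let ?K = "sqrt 2 * (n / (2 * lo)) * (\<beta> / (\<beta> - 2)) + hi * (4 / (3 * \<rho>) * (l * n / 4) powr \<rho>)"
  have r: "cmod (LBINT u. R u * f u) \<le> ?k" "cmod (LBINT u. cnj (R u) * f u) \<le> ?k"
    by (rule integral_envelope_bound[OF \<beta> _ f f_le]; use R_le in simp)+
  have k0: "0 \<le> ?k" using \<beta> n' hi by simp
  have K0: "0 \<le> ?K" using \<beta> n lo hi by (auto simp: \<rho>_def intro!: add_nonneg_nonneg mult_nonneg_nonneg divide_nonneg_nonneg)
  have hK: "sqrt ((cmod (LBINT u. H u * f u))\<^sup>2 + (cmod (LBINT u. cnj (H u) * f u))\<^sup>2) \<le> ?K"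
    using unit_amplitude_bound[OF \<beta> l lo n \<alpha>_cont \<alpha>_lo \<alpha>_hi \<alpha>_0 \<alpha>_lip \<Gamma>_0 \<Gamma>_deriv f f_le] K0
    unfolding H_def \<rho>_def by (intro real_le_lsqrt) auto
  have "sqrt ((cmod (LBINT u. G u * f u))\<^sup>2 + (cmod (LBINT u. cnj (G u) * f u))\<^sup>2)
      \<le> sqrt ((?k + \<bar>a 0\<bar> * cmod (LBINT u. H u * f u))\<^sup>2 + (?k + \<bar>a 0\<bar> * cmod (LBINT u. cnj (H u) * f u))\<^sup>2)"
    using 1 2 r by (intro real_sqrt_le_mono add_mono power_mono) auto
  also have "\<dots> \<le> sqrt (?k\<^sup>2 + ?k\<^sup>2)
      + sqrt ((\<bar>a 0\<bar> * cmod (LBINT u. H u * f u))\<^sup>2 + (\<bar>a 0\<bar> * cmod (LBINT u. cnj (H u) * f u))\<^sup>2)"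
    by (rule real_sqrt_sum_squares_triangle_ineq)
  also have "sqrt (?k\<^sup>2 + ?k\<^sup>2) = sqrt 2 * ?k"
    using k0 by (simp only: mult_2[symmetric] real_sqrt_mult real_sqrt_abs abs_of_nonneg)
  also have "sqrt ((\<bar>a 0\<bar> * cmod (LBINT u. H u * f u))\<^sup>2 + (\<bar>a 0\<bar> * cmod (LBINT u. cnj (H u) * f u))\<^sup>2)
      = \<bar>a 0\<bar> * sqrt ((cmod (LBINT u. H u * f u))\<^sup>2 + (cmod (LBINT u. cnj (H u) * f u))\<^sup>2)"
    by (simp only: power_mult_distrib distrib_left[symmetric] real_sqrt_mult real_sqrt_abs abs_abs)
  also have "sqrt 2 * ?k + \<dots> \<le> sqrt 2 * ?k + \<bar>a 0\<bar> * ?K"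
    using hK by (intro add_left_mono mult_left_mono) auto
  also have "\<dots> = sqrt 2 * (n' * hi + \<bar>a 0\<bar> * (n / (2 * lo))) * (\<beta> / (\<beta> - 2))
        + \<bar>a 0\<bar> * hi * (4 / (3 * \<rho>) * (l * n / 4) powr \<rho>)"
    by (simp only: algebra_simps)
  finally show ?thesis by (rule sqrt_le_D)
qed

subsection \<open>Second moments of random integrals\<close>

lemma borel_measurable_cnj [measurable]: "cnj \<in> borel_measurable borel"
  by (intro borel_measurable_continuous_onI continuous_intros)

lemma integrable_product_lborel:
  fixes f g :: "real \<Rightarrow> 'b::{banach, second_countable_topology, real_normed_field}"
  assumes f: "integrable lborel f" and g: "integrable lborel g"
  shows "integrable (lborel \<Otimes>\<^sub>M lborel) (\<lambda>p. f (fst p) * g (snd p))"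
proof -
  have [measurable]: "f \<in> borel_measurable borel" "g \<in> borel_measurable borel"
    using f g borel_measurable_integrable by force+
  show ?thesis
    by (rule lborel_pair.Fubini_integrable) (use f g in \<open>auto simp: norm_mult\<close>)
qed

text \<open>Fubini, justified by the uniform second moment bound and the integrability of
  \<open>f\<close>. The measure is only assumed finite so that the lemma serves twice: on the
  probability space, and with frequency in the role of \<omega> under the spectral measure.\<close>

lemma second_moment_of_integral:
  fixes D :: "real \<Rightarrow> 'a \<Rightarrow> complex" and f :: "real \<Rightarrow> complex"
  assumes M: "finite_measure M"
    and D: "(\<lambda>(u, \<omega>). D u \<omega>) \<in> borel_measurable (lborel \<Otimes>\<^sub>M M)"
    and D2: "\<And>u. integrable M (\<lambda>\<omega>. (cmod (D u \<omega>))\<^sup>2)"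
    and K: "\<And>u. (\<integral>\<omega>. (cmod (D u \<omega>))\<^sup>2 \<partial>M) \<le> K"
    and f: "integrable lborel f"
  shows "(\<lambda>\<omega>. LBINT u. D u \<omega> * f u) \<in> borel_measurable M"
    and "AE \<omega> in M. integrable lborel (\<lambda>u. D u \<omega> * f u)"
    and "integrable M (\<lambda>\<omega>. (cmod (LBINT u. D u \<omega> * f u))\<^sup>2)"
    and "of_real (\<integral>\<omega>. (cmod (LBINT u. D u \<omega> * f u))\<^sup>2 \<partial>M)
      = (LBINT u. LBINT v. (\<integral>\<omega>. D u \<omega> * cnj (D v \<omega>) \<partial>M) * (f u * cnj (f v)))"
proof -
  interpret M: finite_measure M by fact
  interpret LM: pair_sigma_finite lborel M ..
  interpret LL: pair_sigma_finite "lborel :: real measure" "lborel :: real measure" ..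
  interpret LLM: pair_sigma_finite "lborel \<Otimes>\<^sub>M lborel :: (real \<times> real) measure" M ..
  have [measurable]: "f \<in> borel_measurable borel" using borel_measurable_integrable[OF f] by simp
  have Dc: "(\<lambda>x. D (g x) (h x)) \<in> borel_measurable N"
    if "g \<in> borel_measurable N" "h \<in> measurable N M" for g h and N :: "'z measure"
    using measurable_compose[OF measurable_Pair D, of g N h] that by simp
  have Dm [measurable]: "D u \<in> borel_measurable M" for u by (rule Dc) auto
  have K0: "0 \<le> K" using order_trans[OF integral_nonneg_AE K[of 0]] by simp
  have absD: "integrable M (\<lambda>\<omega>. cmod (D u \<omega>) * cmod (D v \<omega>))"
    "(\<integral>\<omega>. cmod (D u \<omega>) * cmod (D v \<omega>) \<partial>M) \<le> K" for u v
  proof -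
    have le: "cmod (D u \<omega>) * cmod (D v \<omega>) \<le> ((cmod (D u \<omega>))\<^sup>2 + (cmod (D v \<omega>))\<^sup>2) / 2" for \<omega>
      using sum_squares_bound[of "cmod (D u \<omega>)" "cmod (D v \<omega>)"] by simp
    have int: "integrable M (\<lambda>\<omega>. ((cmod (D u \<omega>))\<^sup>2 + (cmod (D v \<omega>))\<^sup>2) / 2)" using D2 by simp
    show i: "integrable M (\<lambda>\<omega>. cmod (D u \<omega>) * cmod (D v \<omega>))"
      by (rule Bochner_Integration.integrable_bound[OF int]) (use le in auto)
    have "(\<integral>\<omega>. cmod (D u \<omega>) * cmod (D v \<omega>) \<partial>M) \<le> (\<integral>\<omega>. ((cmod (D u \<omega>))\<^sup>2 + (cmod (D v \<omega>))\<^sup>2) / 2 \<partial>M)"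
      using i int le by (rule integral_mono)
    also have "\<dots> \<le> K" using K[of u] K[of v] D2 by simp
    finally show "(\<integral>\<omega>. cmod (D u \<omega>) * cmod (D v \<omega>) \<partial>M) \<le> K" .
  qed
  \<comment> \<open>On a finite measure space second moments control first moments; this makes
    almost every path integrable against \<open>f\<close>.\<close>
  have D1: "integrable M (\<lambda>\<omega>. cmod (D u \<omega>))" "(\<integral>\<omega>. cmod (D u \<omega>) \<partial>M) \<le> (measure M (space M) + K) / 2" for u
  proof -
    have le: "cmod (D u \<omega>) \<le> (1 + (cmod (D u \<omega>))\<^sup>2) / 2" for \<omega>
      using sum_squares_bound[of 1 "cmod (D u \<omega>)"] by simp
    have int: "integrable M (\<lambda>\<omega>. (1 + (cmod (D u \<omega>))\<^sup>2) / 2)" using D2 by simp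
    show i: "integrable M (\<lambda>\<omega>. cmod (D u \<omega>))"
      by (rule Bochner_Integration.integrable_bound[OF int]) (use le in auto)
    have "(\<integral>\<omega>. cmod (D u \<omega>) \<partial>M) \<le> (\<integral>\<omega>. (1 + (cmod (D u \<omega>))\<^sup>2) / 2 \<partial>M)"
      using i int le by (rule integral_mono)
    also have "\<dots> \<le> (measure M (space M) + K) / 2" using K[of u] D2 by simp
    finally show "(\<integral>\<omega>. cmod (D u \<omega>) \<partial>M) \<le> (measure M (space M) + K) / 2" .
  qed
  have Df_meas [measurable]: "(\<lambda>(u, \<omega>). D u \<omega> * f u) \<in> borel_measurable (lborel \<Otimes>\<^sub>M M)"
    using Dc[of fst "lborel \<Otimes>\<^sub>M M" snd] by (auto simp: split_beta')
  have Df_swap: "(\<lambda>(\<omega>, u). D u \<omega> * f u) \<in> borel_measurable (M \<Otimes>\<^sub>M lborel)"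
    using Dc[of snd "M \<Otimes>\<^sub>M lborel" fst] by (auto simp: split_beta')
  show meas: "(\<lambda>\<omega>. LBINT u. D u \<omega> * f u) \<in> borel_measurable M"
    using lborel.borel_measurable_lebesgue_integral[OF Df_swap] by simp
  have "integrable (lborel \<Otimes>\<^sub>M M) (case_prod (\<lambda>u \<omega>. D u \<omega> * f u))"
  proof (rule LM.Fubini_integrable)
    show "integrable lborel (\<lambda>u. \<integral>\<omega>. norm (case_prod (\<lambda>u \<omega>. D u \<omega> * f u) (u, \<omega>)) \<partial>M)"
    proof (rule Bochner_Integration.integrable_bound)
      show "integrable lborel (\<lambda>u. (measure M (space M) + K) / 2 * cmod (f u))" using f by simp
      show "(\<lambda>u. \<integral>\<omega>. norm (case_prod (\<lambda>u \<omega>. D u \<omega> * f u) (u, \<omega>)) \<partial>M) \<in> borel_measurable lborel"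
        by measurable
      show "AE u in lborel. norm (\<integral>\<omega>. norm (case_prod (\<lambda>u \<omega>. D u \<omega> * f u) (u, \<omega>)) \<partial>M)
          \<le> norm ((measure M (space M) + K) / 2 * cmod (f u))"
        using mult_right_mono[OF D1(2) norm_ge_zero] by (intro AE_I2) (auto simp: norm_mult intro: order_trans[OF _ abs_ge_self])
    qed
    show "AE u in lborel. integrable M (\<lambda>\<omega>. case_prod (\<lambda>u \<omega>. D u \<omega> * f u) (u, \<omega>))"
      using D1(1) by (auto intro!: AE_I2 integrable_mult_left integrable_norm_cancel[OF D1(1)])
  qed fact
  then show AEint: "AE \<omega> in M. integrable lborel (\<lambda>u. D u \<omega> * f u)"
    by (rule LM.AE_integrable_snd)
  define F where "F = (\<lambda>p \<omega>. D (fst p) \<omega> * cnj (D (snd p) \<omega>) * (f (fst p) * cnj (f (snd p))))"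
  have F_meas: "case_prod F \<in> borel_measurable ((lborel \<Otimes>\<^sub>M lborel) \<Otimes>\<^sub>M M)"
  proof -
    have [measurable]: "(\<lambda>x. D (fst (fst x)) (snd x)) \<in> borel_measurable ((lborel \<Otimes>\<^sub>M lborel) \<Otimes>\<^sub>M M)"
      "(\<lambda>x. D (snd (fst x)) (snd x)) \<in> borel_measurable ((lborel \<Otimes>\<^sub>M lborel) \<Otimes>\<^sub>M M)"
      by (auto intro!: Dc)
    show ?thesis unfolding F_def split_beta' by measurable
  qed
  have f2: "integrable (lborel \<Otimes>\<^sub>M lborel) (\<lambda>p. f (fst p) * cnj (f (snd p)))"
    by (rule integrable_product_lborel) (use f in auto)
  have F_int: "integrable ((lborel \<Otimes>\<^sub>M lborel) \<Otimes>\<^sub>M M) (case_prod F)"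
  proof (rule LLM.Fubini_integrable[OF F_meas])
    show "integrable (lborel \<Otimes>\<^sub>M lborel) (\<lambda>p. \<integral>\<omega>. norm (case_prod F (p, \<omega>)) \<partial>M)"
    proof (rule Bochner_Integration.integrable_bound)
      show "integrable (lborel \<Otimes>\<^sub>M lborel) (\<lambda>p. K * cmod (f (fst p) * cnj (f (snd p))))"
        using integrable_norm[OF f2] by (rule integrable_mult_right)
      show "(\<lambda>p. \<integral>\<omega>. norm (case_prod F (p, \<omega>)) \<partial>M) \<in> borel_measurable (lborel \<Otimes>\<^sub>M lborel)"
        using measurable_compose[OF F_meas borel_measurable_norm]
        by (intro M.borel_measurable_lebesgue_integral) (simp add: split_beta')
      show "AE p in lborel \<Otimes>\<^sub>M lborel. norm (\<integral>\<omega>. norm (case_prod F (p, \<omega>)) \<partial>M)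
          \<le> norm (K * cmod (f (fst p) * cnj (f (snd p))))"
        using mult_right_mono[OF absD(2), of "cmod (f _) * cmod (f _)"] K0 by (intro AE_I2) (simp add: F_def norm_mult)
    qed
    show "AE p in lborel \<Otimes>\<^sub>M lborel. integrable M (\<lambda>\<omega>. case_prod F (p, \<omega>))"
    proof (intro AE_I2)
      fix p
      have "integrable M (\<lambda>\<omega>. D (fst p) \<omega> * cnj (D (snd p) \<omega>))"
        by (rule Bochner_Integration.integrable_bound[OF absD(1)[of "fst p" "snd p"]]) (auto simp: norm_mult)
      then show "integrable M (\<lambda>\<omega>. case_prod F (p, \<omega>))" unfolding F_def by simp
    qed
  qed
  \<comment> \<open>The square factors into a double integral only for those \<omega> whose path is
    integrable; elsewhere the Bochner integral has its default value 0.\<close>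
  have sq: "AE \<omega> in M. (\<integral>p. F p \<omega> \<partial>(lborel \<Otimes>\<^sub>M lborel)) = of_real ((cmod (LBINT u. D u \<omega> * f u))\<^sup>2)"
    using AEint
  proof eventually_elim
    case (elim \<omega>)
    have "integrable (lborel \<Otimes>\<^sub>M lborel) (\<lambda>p. (D (fst p) \<omega> * f (fst p)) * cnj (D (snd p) \<omega> * f (snd p)))"
      by (rule integrable_product_lborel) (use elim in \<open>auto simp del: complex_cnj_mult\<close>)
    moreover have "(\<lambda>p. (D (fst p) \<omega> * f (fst p)) * cnj (D (snd p) \<omega> * f (snd p))) = (\<lambda>p. F p \<omega>)"
      by (auto simp: F_def)
    ultimately have i: "integrable (lborel \<Otimes>\<^sub>M lborel) (\<lambda>p. F p \<omega>)" by simp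
    have "(\<integral>p. F p \<omega> \<partial>(lborel \<Otimes>\<^sub>M lborel)) = (LBINT u. LBINT v. F (u, v) \<omega>)"
      using lborel_pair.integral_fst'[OF i] by simp
    also have "\<dots> = (LBINT u. LBINT v. (D u \<omega> * f u) * cnj (D v \<omega> * f v))"
      by (simp add: F_def mult_ac)
    also have "\<dots> = (LBINT u. (D u \<omega> * f u) * cnj (LBINT v. D v \<omega> * f v))"
      by (simp only: integral_mult_right_zero Bochner_Integration.integral_cnj)
    also have "\<dots> = (LBINT u. D u \<omega> * f u) * cnj (LBINT v. D v \<omega> * f v)"
      by (simp only: integral_mult_left_zero)
    also have "\<dots> = of_real ((cmod (LBINT u. D u \<omega> * f u))\<^sup>2)"
      by (simp only: complex_norm_square)
    finally show ?case .
  qed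
  have "integrable M (\<lambda>\<omega>. complex_of_real ((cmod (LBINT u. D u \<omega> * f u))\<^sup>2))"
  proof (rule integrable_cong_AE_imp[OF LLM.integrable_snd[OF F_int]])
    show "(\<lambda>\<omega>. complex_of_real ((cmod (LBINT u. D u \<omega> * f u))\<^sup>2)) \<in> borel_measurable M"
      using meas by measurable
    show "AE \<omega> in M. (\<integral>p. F p \<omega> \<partial>(lborel \<Otimes>\<^sub>M lborel)) = complex_of_real ((cmod (LBINT u. D u \<omega> * f u))\<^sup>2)"
      by (rule sq)
  qed
  then show "integrable M (\<lambda>\<omega>. (cmod (LBINT u. D u \<omega> * f u))\<^sup>2)"
    by (simp only: complex_of_real_integrable_eq)
  have "of_real (\<integral>\<omega>. (cmod (LBINT u. D u \<omega> * f u))\<^sup>2 \<partial>M)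
      = (\<integral>\<omega>. complex_of_real ((cmod (LBINT u. D u \<omega> * f u))\<^sup>2) \<partial>M)"
    by (simp only: integral_complex_of_real)
  also have "\<dots> = (\<integral>\<omega>. (\<integral>p. F p \<omega> \<partial>(lborel \<Otimes>\<^sub>M lborel)) \<partial>M)"
  proof (rule integral_cong_AE)
    show "(\<lambda>\<omega>. \<integral>p. F p \<omega> \<partial>(lborel \<Otimes>\<^sub>M lborel)) \<in> borel_measurable M"
      using LLM.integrable_snd[OF F_int] by (rule borel_measurable_integrable)
    show "AE \<omega> in M. complex_of_real ((cmod (LBINT u. D u \<omega> * f u))\<^sup>2) = (\<integral>p. F p \<omega> \<partial>(lborel \<Otimes>\<^sub>M lborel))"
      using sq by eventually_elim simp
  qed (use meas in measurable)
  also have "\<dots> = (\<integral>p. (\<integral>\<omega>. F p \<omega> \<partial>M) \<partial>(lborel \<Otimes>\<^sub>M lborel))"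
    by (rule LLM.Fubini_integral[OF F_int])
  also have "\<dots> = (LBINT u. LBINT v. (\<integral>\<omega>. F (u, v) \<omega> \<partial>M))"
    using lborel_pair.integral_fst'[OF LLM.integrable_fst[OF F_int]] by simp
  also have "\<dots> = (LBINT u. LBINT v. (\<integral>\<omega>. D u \<omega> * cnj (D v \<omega>) \<partial>M) * (f u * cnj (f v)))"
    by (simp add: F_def)
  finally show "of_real (\<integral>\<omega>. (cmod (LBINT u. D u \<omega> * f u))\<^sup>2 \<partial>M)
      = (LBINT u. LBINT v. (\<integral>\<omega>. D u \<omega> * cnj (D v \<omega>) \<partial>M) * (f u * cnj (f v)))" .
qed

section \<open>Cauchy-Schwarz and Minkowski with the spectrum as weight\<close>

text \<open>The integral of \<open>S x * (g x - t)\<^sup>2\<close> is a nonnegative quadratic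
  polynomial in \<open>t\<close>; evaluate it at its minimum.\<close>

lemma integral_weighted_CS:
  fixes S g :: "real \<Rightarrow> real"
  assumes S0: "\<And>x. 0 \<le> S x" and S: "integrable lborel S" and Sg: "integrable lborel (\<lambda>x. S x * g x)"
    and Sg2: "integrable lborel (\<lambda>x. S x * (g x)\<^sup>2)"
  shows "(LBINT x. S x * g x)\<^sup>2 \<le> (LBINT x. S x) * (LBINT x. S x * (g x)\<^sup>2)"
proof -
  define A B C where "A = (LBINT x. S x)" and "B = (LBINT x. S x * g x)" and "C = (LBINT x. S x * (g x)\<^sup>2)"
  have q: "0 \<le> C - 2 * t * B + t\<^sup>2 * A" for t
  proof -
    have "0 \<le> (LBINT x. S x * (g x - t)\<^sup>2)" using S0 by simp
    also have "(\<lambda>x. S x * (g x - t)\<^sup>2) = (\<lambda>x. S x * (g x)\<^sup>2 - 2 * t * (S x * g x) + t\<^sup>2 * S x)"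
      by (simp add: fun_eq_iff power2_diff algebra_simps)
    also have "(LBINT x. S x * (g x)\<^sup>2 - 2 * t * (S x * g x) + t\<^sup>2 * S x) = C - 2 * t * B + t\<^sup>2 * A"
      using S Sg Sg2 by (simp add: A_def B_def C_def)
    finally show ?thesis .
  qed
  have A0: "0 \<le> A" using S0 by (simp add: A_def)
  have "B\<^sup>2 \<le> A * C"
  proof (cases "A = 0")
    case True
    have "B = 0"
    proof (rule ccontr)
      assume "B \<noteq> 0"
      \<comment> \<open>With \<open>A = 0\<close> the polynomial is affine, and at this
        \<open>t\<close> its value is -1.\<close>
      then show False using q[of "(C + 1) / (2 * B)"] True by simp
    qed
    then show ?thesis using True by simp
  next
    case False
    then have A: "0 < A" using A0 by simp
    have "0 \<le> A * (C - 2 * (B / A) * B + (B / A)\<^sup>2 * A)" using q[of "B / A"] A by simp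
    also have "\<dots> = A * C - B\<^sup>2" using A by (simp add: field_simps power2_eq_square)
    finally show ?thesis by simp
  qed
  then show ?thesis by (simp add: A_def B_def C_def)
qed

text \<open>Expand the square and bound the cross term by Cauchy-Schwarz. \<open>I\<close> will be
  taken over positive frequencies only, hence \<open>2 * I\<^sup>2\<close> on the whole line. The
  final division by 2 thus removes both this 2 and the \<open>sqrt 2\<close> on \<kappa>.\<close>

lemma spectral_minkowski:
  fixes S :: "real \<Rightarrow> real"
  assumes S0: "\<And>x. 0 \<le> S x" and S: "integrable lborel S"
    and Sr: "integrable lborel (\<lambda>x. \<bar>x\<bar> powr (2 * \<rho>) * S x)"
    and \<sigma>: "(LBINT x. S x) = \<sigma>\<^sup>2" "0 \<le> \<sigma>" and I: "(LBINT x. \<bar>x\<bar> powr (2 * \<rho>) * S x) = 2 * I\<^sup>2" "0 \<le> I"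
    and kJ: "0 \<le> \<kappa>" "0 \<le> J"
  shows "integrable lborel (\<lambda>x. S x * (sqrt 2 * \<kappa> + J * \<bar>x\<bar> powr \<rho>)\<^sup>2)"
    and "(LBINT x. S x * (sqrt 2 * \<kappa> + J * \<bar>x\<bar> powr \<rho>)\<^sup>2) / 2 \<le> (\<kappa> * \<sigma> + J * I)\<^sup>2"
proof -
  define g where "g = (\<lambda>x::real. \<bar>x\<bar> powr \<rho>)"
  have [measurable]: "S \<in> borel_measurable borel" using borel_measurable_integrable[OF S] by simp
  have g2: "(g x)\<^sup>2 = \<bar>x\<bar> powr (2 * \<rho>)" for x
    by (simp add: g_def power2_eq_square flip: powr_add)
  have Sg2: "integrable lborel (\<lambda>x. S x * (g x)\<^sup>2)" using Sr by (simp add: g2 mult.commute)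
  have Sg: "integrable lborel (\<lambda>x. S x * g x)"
  proof (rule Bochner_Integration.integrable_bound[OF Bochner_Integration.integrable_add[OF S Sg2]])
    have "g x \<le> 1 + (g x)\<^sup>2" for x
      using sum_squares_bound[of 1 "g x"] zero_le_power2[of "g x"] unfolding power_one mult_1_right by linarith
    then have "S x * g x \<le> S x * (1 + (g x)\<^sup>2)" for x using S0 by (intro mult_left_mono)
    then show "AE x in lborel. norm (S x * g x) \<le> norm (S x + S x * (g x)\<^sup>2)"
      using S0 by (intro AE_I2) (auto simp: g_def algebra_simps)
  qed (simp add: g_def)
  have exp: "S x * (sqrt 2 * \<kappa> + J * g x)\<^sup>2
      = 2 * \<kappa>\<^sup>2 * S x + 2 * sqrt 2 * \<kappa> * J * (S x * g x) + J\<^sup>2 * (S x * (g x)\<^sup>2)" for x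
    by (simp add: power2_sum power_mult_distrib algebra_simps)
  show "integrable lborel (\<lambda>x. S x * (sqrt 2 * \<kappa> + J * \<bar>x\<bar> powr \<rho>)\<^sup>2)"
    unfolding g_def[symmetric, unfolded fun_eq_iff, rule_format] exp using S Sg Sg2 by simp
  have "(LBINT x. S x * g x)\<^sup>2 \<le> \<sigma>\<^sup>2 * (2 * I\<^sup>2)"
    using integral_weighted_CS[OF S0 S Sg Sg2] \<sigma> I by (simp add: g2 mult.commute)
  also have "\<dots> = (sqrt 2 * \<sigma> * I)\<^sup>2" by (simp add: power_mult_distrib)
  finally have CS: "(LBINT x. S x * g x) \<le> sqrt 2 * \<sigma> * I"
    by (rule power2_le_imp_le) (use \<sigma> I in simp)
  have "(LBINT x. S x * (sqrt 2 * \<kappa> + J * g x)\<^sup>2)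
      = 2 * \<kappa>\<^sup>2 * \<sigma>\<^sup>2 + 2 * sqrt 2 * \<kappa> * J * (LBINT x. S x * g x) + J\<^sup>2 * (2 * I\<^sup>2)"
    unfolding exp using S Sg Sg2 \<sigma> I by (simp add: g2 mult.commute)
  also have "\<dots> \<le> 2 * \<kappa>\<^sup>2 * \<sigma>\<^sup>2 + 2 * sqrt 2 * \<kappa> * J * (sqrt 2 * \<sigma> * I) + J\<^sup>2 * (2 * I\<^sup>2)"
    using CS kJ by (intro add_right_mono add_left_mono mult_left_mono) auto
  also have "\<dots> = 2 * (\<kappa> * \<sigma> + J * I)\<^sup>2"
    by (simp add: power2_sum power_mult_distrib algebra_simps)
  finally show "(LBINT x. S x * (sqrt 2 * \<kappa> + J * \<bar>x\<bar> powr \<rho>)\<^sup>2) / 2 \<le> (\<kappa> * \<sigma> + J * I)\<^sup>2"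
    by (simp add: g_def)
qed

subsection \<open>Spectral representation\<close>

text \<open>Reflecting a density conjugates its characteristic function. If that is real, the
  normalised density and its reflection have the same characteristic function, and Levy's uniqueness
  theorem identifies them. Normalisation fails only when the total mass is 0, where \<open>S\<close>
  vanishes almost everywhere.\<close>

lemma even_of_real_fourier:
  fixes S :: "real \<Rightarrow> real"
  assumes S0: "\<And>x. 0 \<le> S x" and S: "integrable lborel S"
    and real: "\<And>t. (LBINT x. of_real (S x) * exp (\<i> * of_real (t * x))) \<in> \<real>"
  shows "AE x in lborel. S (- x) = S x"
proof -
  have [measurable]: "S \<in> borel_measurable borel" using borel_measurable_integrable[OF S] by simp
  have S': "integrable lborel (\<lambda>x. S (- x))"
    using lborel_integrable_real_affine[OF S, of "- 1" 0] by simp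
  have eqi: "(LBINT x. S (- x)) = (LBINT x. S x)"
    using lborel_integral_real_affine[of "- 1" S 0] by simp
  define c where "c = (LBINT x. S x)"
  have c0: "0 \<le> c" using S0 by (simp add: c_def)
  show ?thesis
  proof (cases "c = 0")
    case True
    have "AE x in lborel. S x = 0"
      using integral_nonneg_eq_0_iff_AE[OF S] S0 True by (simp add: c_def)
    moreover have "AE x in lborel. S (- x) = 0"
      using integral_nonneg_eq_0_iff_AE[OF S'] S0 True eqi by (simp add: c_def)
    ultimately show ?thesis by eventually_elim simp
  next
    case False
    then have c: "0 < c" using c0 by simp
    have dist: "real_distribution (density lborel (\<lambda>x. ennreal (g x / c)))"
      if [measurable]: "g \<in> borel_measurable borel" and g0: "\<And>x. 0 \<le> g x" and g: "integrable lborel g" "(LBINT x. g x) = c" for g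
    proof -
      have "prob_space (density lborel (\<lambda>x. ennreal (g x / c)))"
      proof
        have "(\<integral>\<^sup>+ x. ennreal (g x / c) \<partial>lborel) = ennreal (LBINT x. g x / c)"
          using g g0 c by (intro nn_integral_eq_integral) auto
        then show "emeasure (density lborel (\<lambda>x. ennreal (g x / c))) (space (density lborel (\<lambda>x. ennreal (g x / c)))) = 1"
          using g c by (simp add: emeasure_density)
      qed
      then show ?thesis
        by (auto simp: real_distribution_def real_distribution_axioms_def)
    qed
    have char: "char (density lborel (\<lambda>x. ennreal (g x / c))) t
        = (LBINT x. of_real (g x) * exp (\<i> * of_real (t * x))) / of_real c"
      if [measurable]: "g \<in> borel_measurable borel" and g0: "\<And>x. 0 \<le> g x" for g t
    proof -
      have "char (density lborel (\<lambda>x. ennreal (g x / c))) t = (LBINT x. (g x / c) *\<^sub>R exp (\<i> * of_real (t * x)))"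
        unfolding char_def using g0 c by (subst integral_density) auto
      also have "\<dots> = (LBINT x. (of_real (g x) * exp (\<i> * of_real (t * x))) / of_real c)"
        by (intro Bochner_Integration.integral_cong) (auto simp: scaleR_conv_of_real)
      also have "\<dots> = (LBINT x. of_real (g x) * exp (\<i> * of_real (t * x))) / of_real c"
        by (rule integral_divide_zero)
      finally show ?thesis .
    qed
    have "char (density lborel (\<lambda>x. ennreal (S (- x) / c))) t = char (density lborel (\<lambda>x. ennreal (S x / c))) t" for t
    proof -
      have "(LBINT x. of_real (S (- x)) * exp (\<i> * of_real (t * x)))
          = (LBINT x. of_real (S x) * exp (\<i> * of_real (t * (- x))))"
        using lborel_integral_real_affine[of "- 1" "\<lambda>x. of_real (S x) * exp (\<i> * of_real (t * (- x)))" 0] by simp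
      also have "\<dots> = (LBINT x. cnj (of_real (S x) * exp (\<i> * of_real (t * x))))"
        by (simp add: exp_cnj)
      also have "\<dots> = cnj (LBINT x. of_real (S x) * exp (\<i> * of_real (t * x)))"
        by (rule Bochner_Integration.integral_cnj)
      also have "\<dots> = (LBINT x. of_real (S x) * exp (\<i> * of_real (t * x)))"
        using real[of t] by (simp only: Reals_cnj_iff)
      finally show ?thesis using S0 by (subst (1 2) char) auto
    qed
    then have "density lborel (\<lambda>x. ennreal (S (- x) / c)) = density lborel (\<lambda>x. ennreal (S x / c))"
      using S0 S S' eqi by (intro Levy_uniqueness dist) (auto simp: c_def fun_eq_iff)
    then have "AE x in lborel. ennreal (S (- x) / c) = ennreal (S x / c)"
      by (intro sigma_finite_measure.density_unique[OF sigma_finite_lborel]) auto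
    then show ?thesis by eventually_elim (use S0 c in auto)
  qed
qed

text \<open>The exponentials under the spectral measure have the same covariance as
  \<open>X\<close>, so \<open>D\<close> may be replaced by \<open>G\<close> without changing second
  moments. The covariance of \<open>D\<close> is real, so the conjugate of \<open>G\<close> serves
  as well; averaging the two gives the symmetric form. The amplitudes are arbitrary so that one of
  them can be set to 0.\<close>

lemma spectral_representation:
  fixes M :: "'a measure" and X :: "real \<Rightarrow> 'a \<Rightarrow> real" and S c\<^sub>1 c\<^sub>2 g\<^sub>1 g\<^sub>2 :: "real \<Rightarrow> real" and f :: "real \<Rightarrow> complex"
  assumes M: "prob_space M"
    and X_rv: "\<And>t. X t \<in> borel_measurable M"
    and X_joint: "(\<lambda>(t, \<omega>). X t \<omega>) \<in> borel_measurable (lborel \<Otimes>\<^sub>M M)"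
    and X_2nd: "\<And>t. integrable M (\<lambda>\<omega>. (X t \<omega>)\<^sup>2)"
    and S0: "\<And>\<nu>. 0 \<le> S \<nu>" and S: "integrable lborel S"
    and X_cov: "\<And>t s. complex_of_real (\<integral>\<omega>. X t \<omega> * X s \<omega> \<partial>M)
      = (LBINT \<nu>. of_real (S \<nu>) * exp (\<i> * of_real (2 * pi * \<nu> * (t - s))))"
    and [measurable]: "c\<^sub>1 \<in> borel_measurable borel" "c\<^sub>2 \<in> borel_measurable borel"
      "g\<^sub>1 \<in> borel_measurable borel" "g\<^sub>2 \<in> borel_measurable borel"
    and c_le: "\<And>u. \<bar>c\<^sub>1 u\<bar> \<le> B" "\<And>u. \<bar>c\<^sub>2 u\<bar> \<le> B"
    and f: "integrable lborel f"
  defines "D \<equiv> \<lambda>u \<omega>. of_real (c\<^sub>1 u * X (g\<^sub>1 u) \<omega> - c\<^sub>2 u * X (g\<^sub>2 u) \<omega>)"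
    and "G \<equiv> \<lambda>u \<nu>. of_real (c\<^sub>1 u) * exp (\<i> * of_real (2 * pi * \<nu> * g\<^sub>1 u)) - of_real (c\<^sub>2 u) * exp (\<i> * of_real (2 * pi * \<nu> * g\<^sub>2 u))"
  shows "(\<lambda>\<omega>. LBINT u. D u \<omega> * f u) \<in> borel_measurable M"
    and "AE \<omega> in M. integrable lborel (\<lambda>u. D u \<omega> * f u)"
    and "integrable M (\<lambda>\<omega>. (cmod (LBINT u. D u \<omega> * f u))\<^sup>2)"
    and "integrable lborel (\<lambda>\<nu>. S \<nu> * ((cmod (LBINT u. G u \<nu> * f u))\<^sup>2 + (cmod (LBINT u. cnj (G u \<nu>) * f u))\<^sup>2))"
    and "(\<integral>\<omega>. (cmod (LBINT u. D u \<omega> * f u))\<^sup>2 \<partial>M)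
      = (LBINT \<nu>. S \<nu> * ((cmod (LBINT u. G u \<nu> * f u))\<^sup>2 + (cmod (LBINT u. cnj (G u \<nu>) * f u))\<^sup>2)) / 2"
proof -
  interpret prob_space M by fact
  note [measurable] = X_rv
  have [measurable]: "S \<in> borel_measurable borel" using borel_measurable_integrable[OF S] by simp
  have [measurable]: "f \<in> borel_measurable borel" using borel_measurable_integrable[OF f] by simp
  have B: "0 \<le> B" using order_trans[OF abs_ge_zero c_le(1)] .
  have XX: "integrable M (\<lambda>\<omega>. X t \<omega> * X s \<omega>)" for t s
  proof (rule Bochner_Integration.integrable_bound[OF Bochner_Integration.integrable_add[OF X_2nd[of t] X_2nd[of s]]])
    have "\<bar>X t \<omega> * X s \<omega>\<bar> \<le> (X t \<omega>)\<^sup>2 + (X s \<omega>)\<^sup>2" for \<omega>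
      using sum_squares_bound[of "\<bar>X t \<omega>\<bar>" "\<bar>X s \<omega>\<bar>"] mult_nonneg_nonneg[of "\<bar>X t \<omega>\<bar>" "\<bar>X s \<omega>\<bar>"]
      unfolding abs_mult power2_abs mult.assoc[symmetric] by linarith
    then show "AE \<omega> in M. norm (X t \<omega> * X s \<omega>) \<le> norm ((X t \<omega>)\<^sup>2 + (X s \<omega>)\<^sup>2)"
      by simp
  qed simp
  define v where "v = (LBINT \<nu>. S \<nu>)"
  have var: "(\<integral>\<omega>. (X t \<omega>)\<^sup>2 \<partial>M) = v" for t
    using X_cov[of t t] by (simp add: v_def power2_eq_square)
  have diff_sq: "(x - y)\<^sup>2 \<le> 2 * (x\<^sup>2 + y\<^sup>2)" for x y :: real
    using zero_le_power2[of "x + y"] by (simp add: power2_sum power2_diff)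
  have D_sq: "(cmod (D u \<omega>))\<^sup>2 \<le> 2 * B\<^sup>2 * ((X (g\<^sub>1 u) \<omega>)\<^sup>2 + (X (g\<^sub>2 u) \<omega>)\<^sup>2)" for u \<omega>
  proof -
    have sq: "(c\<^sub>1 u)\<^sup>2 \<le> B\<^sup>2" "(c\<^sub>2 u)\<^sup>2 \<le> B\<^sup>2"
      using power_mono[OF c_le(1)[of u], of 2] power_mono[OF c_le(2)[of u], of 2] by simp_all
    have "(cmod (D u \<omega>))\<^sup>2 = (c\<^sub>1 u * X (g\<^sub>1 u) \<omega> - c\<^sub>2 u * X (g\<^sub>2 u) \<omega>)\<^sup>2"
      unfolding D_def norm_of_real by simp
    also have "\<dots> \<le> 2 * ((c\<^sub>1 u * X (g\<^sub>1 u) \<omega>)\<^sup>2 + (c\<^sub>2 u * X (g\<^sub>2 u) \<omega>)\<^sup>2)"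
      by (rule diff_sq)
    also have "\<dots> \<le> 2 * (B\<^sup>2 * (X (g\<^sub>1 u) \<omega>)\<^sup>2 + B\<^sup>2 * (X (g\<^sub>2 u) \<omega>)\<^sup>2)"
      unfolding power_mult_distrib using sq by (intro mult_left_mono add_mono mult_right_mono) auto
    finally show ?thesis by (simp add: algebra_simps)
  qed
  have Xc: "(\<lambda>x. X (g (fst x)) (snd x)) \<in> borel_measurable (lborel \<Otimes>\<^sub>M M)"
    if [measurable]: "g \<in> borel_measurable borel" for g
  proof -
    have "(\<lambda>x. (g (fst x), snd x)) \<in> lborel \<Otimes>\<^sub>M M \<rightarrow>\<^sub>M lborel \<Otimes>\<^sub>M M" by measurable
    from measurable_compose[OF this X_joint] show ?thesis by simp
  qed
  have D_meas: "(\<lambda>(u, \<omega>). D u \<omega>) \<in> borel_measurable (lborel \<Otimes>\<^sub>M M)"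
    using Xc[of g\<^sub>1] Xc[of g\<^sub>2] unfolding D_def split_beta' by measurable
  have [measurable]: "D u \<in> borel_measurable M" for u unfolding D_def by measurable
  have D2: "integrable M (\<lambda>\<omega>. (cmod (D u \<omega>))\<^sup>2)" for u
    by (rule Bochner_Integration.integrable_bound[where f = "\<lambda>\<omega>. 2 * B\<^sup>2 * ((X (g\<^sub>1 u) \<omega>)\<^sup>2 + (X (g\<^sub>2 u) \<omega>)\<^sup>2)"])
      (use D_sq X_2nd in \<open>auto intro!: AE_I2 intro: order_trans[OF _ abs_ge_self]\<close>)
  have DK: "(\<integral>\<omega>. (cmod (D u \<omega>))\<^sup>2 \<partial>M) \<le> 2 * B\<^sup>2 * (v + v)" for u
  proof -
    have "(\<integral>\<omega>. (cmod (D u \<omega>))\<^sup>2 \<partial>M) \<le> (\<integral>\<omega>. 2 * B\<^sup>2 * ((X (g\<^sub>1 u) \<omega>)\<^sup>2 + (X (g\<^sub>2 u) \<omega>)\<^sup>2) \<partial>M)"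
      using D2 D_sq X_2nd by (intro integral_mono) auto
    also have "\<dots> = 2 * B\<^sup>2 * (v + v)" using X_2nd by (simp add: var)
    finally show ?thesis .
  qed
  note sm = second_moment_of_integral[OF finite_measure_axioms D_meas D2 DK f]
  show "(\<lambda>\<omega>. LBINT u. D u \<omega> * f u) \<in> borel_measurable M"
    and "AE \<omega> in M. integrable lborel (\<lambda>u. D u \<omega> * f u)"
    and "integrable M (\<lambda>\<omega>. (cmod (LBINT u. D u \<omega> * f u))\<^sup>2)"
    by (rule sm)+
  \<comment> \<open>The spectral measure, as a second finite measure space on which
    \<open>second_moment_of_integral\<close> applies.\<close>
  define N where "N = density lborel (\<lambda>\<nu>. ennreal (S \<nu>))"
  have sets_N [measurable_cong]: "sets N = sets borel" by (simp add: N_def)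
  have fin: "finite_measure N"
  proof
    have "emeasure N (space N) = (\<integral>\<^sup>+ \<nu>. ennreal (S \<nu>) \<partial>lborel)" by (simp add: N_def emeasure_density)
    also have "\<dots> = ennreal v" unfolding v_def using S S0 by (intro nn_integral_eq_integral) auto
    finally show "emeasure N (space N) \<noteq> \<infinity>" by simp
  qed
  then interpret N: finite_measure N .
  define E where "E = (\<lambda>t \<nu>. exp (\<i> * of_real (2 * pi * \<nu> * t)))"
  have E_meas [measurable]: "(\<lambda>x. E (g x) (h x)) \<in> borel_measurable K"
    if [measurable]: "g \<in> borel_measurable K" "h \<in> borel_measurable K" for g h and K :: "'z measure"
  proof -
    have "(\<lambda>y::real. exp (\<i> * of_real y) :: complex) \<in> borel_measurable borel"
      by (intro borel_measurable_continuous_onI continuous_intros)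
    from measurable_compose[OF _ this, of "\<lambda>x. 2 * pi * h x * g x" K] show ?thesis
      unfolding E_def by measurable
  qed
  have E_norm: "cmod (E t \<nu>) = 1" for t \<nu> by (simp only: E_def norm_exp_i_times)
  have EE: "E t \<nu> * cnj (E s \<nu>) = E (t - s) \<nu>" for t s \<nu>
    unfolding E_def exp_cnj exp_add[symmetric] by (rule arg_cong[where f = exp]) (simp add: algebra_simps)
  have E_int: "integrable N (E t)" for t
    by (rule N.integrable_const_bound[where B = 1]) (auto simp: E_norm)
  have E_cov: "(\<integral>\<nu>. E (t - s) \<nu> \<partial>N) = of_real (\<integral>\<omega>. X t \<omega> * X s \<omega> \<partial>M)" for t s
    unfolding X_cov N_def using S0 by (subst integral_density) (auto simp: E_def scaleR_conv_of_real)
  have G: "G u \<nu> = of_real (c\<^sub>1 u) * E (g\<^sub>1 u) \<nu> - of_real (c\<^sub>2 u) * E (g\<^sub>2 u) \<nu>" for u \<nu>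
    by (simp add: G_def E_def)
  have G_le: "cmod (G u \<nu>) \<le> 2 * B" for u \<nu>
  proof -
    have "cmod (G u \<nu>) \<le> cmod (of_real (c\<^sub>1 u) * E (g\<^sub>1 u) \<nu>) + cmod (of_real (c\<^sub>2 u) * E (g\<^sub>2 u) \<nu>)"
      unfolding G by (rule norm_triangle_ineq4)
    also have "\<dots> = \<bar>c\<^sub>1 u\<bar> + \<bar>c\<^sub>2 u\<bar>" unfolding norm_mult E_norm norm_of_real by simp
    also have "\<dots> \<le> 2 * B" using c_le[of u] by simp
    finally show ?thesis .
  qed
  have covG: "(\<integral>\<nu>. G u \<nu> * cnj (G w \<nu>) \<partial>N) = (\<integral>\<omega>. D u \<omega> * cnj (D w \<omega>) \<partial>M)" for u w
  proof -
    have "G u \<nu> * cnj (G w \<nu>) = of_real (c\<^sub>1 u * c\<^sub>1 w) * E (g\<^sub>1 u - g\<^sub>1 w) \<nu> - of_real (c\<^sub>1 u * c\<^sub>2 w) * E (g\<^sub>1 u - g\<^sub>2 w) \<nu>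
        - of_real (c\<^sub>2 u * c\<^sub>1 w) * E (g\<^sub>2 u - g\<^sub>1 w) \<nu> + of_real (c\<^sub>2 u * c\<^sub>2 w) * E (g\<^sub>2 u - g\<^sub>2 w) \<nu>" for \<nu>
      unfolding EE[symmetric] G by (simp add: algebra_simps)
    then have "(\<integral>\<nu>. G u \<nu> * cnj (G w \<nu>) \<partial>N)
        = of_real (c\<^sub>1 u * c\<^sub>1 w) * (\<integral>\<nu>. E (g\<^sub>1 u - g\<^sub>1 w) \<nu> \<partial>N) - of_real (c\<^sub>1 u * c\<^sub>2 w) * (\<integral>\<nu>. E (g\<^sub>1 u - g\<^sub>2 w) \<nu> \<partial>N)
        - of_real (c\<^sub>2 u * c\<^sub>1 w) * (\<integral>\<nu>. E (g\<^sub>2 u - g\<^sub>1 w) \<nu> \<partial>N) + of_real (c\<^sub>2 u * c\<^sub>2 w) * (\<integral>\<nu>. E (g\<^sub>2 u - g\<^sub>2 w) \<nu> \<partial>N)"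
      using E_int by (simp del: of_real_mult)
    also have "\<dots> = of_real (\<integral>\<omega>. c\<^sub>1 u * c\<^sub>1 w * (X (g\<^sub>1 u) \<omega> * X (g\<^sub>1 w) \<omega>) - c\<^sub>1 u * c\<^sub>2 w * (X (g\<^sub>1 u) \<omega> * X (g\<^sub>2 w) \<omega>)
        - c\<^sub>2 u * c\<^sub>1 w * (X (g\<^sub>2 u) \<omega> * X (g\<^sub>1 w) \<omega>) + c\<^sub>2 u * c\<^sub>2 w * (X (g\<^sub>2 u) \<omega> * X (g\<^sub>2 w) \<omega>) \<partial>M)"
      unfolding E_cov using XX by simp
    also have "\<dots> = (\<integral>\<omega>. of_real ((c\<^sub>1 u * X (g\<^sub>1 u) \<omega> - c\<^sub>2 u * X (g\<^sub>2 u) \<omega>) * (c\<^sub>1 w * X (g\<^sub>1 w) \<omega> - c\<^sub>2 w * X (g\<^sub>2 w) \<omega>)) \<partial>M)"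
      unfolding integral_complex_of_real[symmetric]
      by (intro Bochner_Integration.integral_cong refl arg_cong[where f = of_real]) (simp add: algebra_simps)
    also have "\<dots> = (\<integral>\<omega>. D u \<omega> * cnj (D w \<omega>) \<partial>M)" by (simp add: D_def)
    finally show ?thesis .
  qed
  have cnj_DD: "cnj (\<integral>\<omega>. D u \<omega> * cnj (D w \<omega>) \<partial>M) = (\<integral>\<omega>. D u \<omega> * cnj (D w \<omega>) \<partial>M)" for u w
  proof -
    have "cnj (D u \<omega> * cnj (D w \<omega>)) = D u \<omega> * cnj (D w \<omega>)" for \<omega> by (simp add: D_def)
    then show ?thesis unfolding Bochner_Integration.integral_cnj[symmetric] by presburger
  qed
  \<comment> \<open>\<open>H\<close> is any bounded kernel on the spectral side with the covariance
    of \<open>D\<close>; it is instantiated by \<open>G\<close> and by its conjugate.\<close>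
  have smN: "integrable N (\<lambda>\<nu>. (cmod (LBINT u. H u \<nu> * f u))\<^sup>2)"
    "(\<integral>\<nu>. (cmod (LBINT u. H u \<nu> * f u))\<^sup>2 \<partial>N) = (\<integral>\<omega>. (cmod (LBINT u. D u \<omega> * f u))\<^sup>2 \<partial>M)"
    if H_meas: "(\<lambda>(u, \<nu>). H u \<nu>) \<in> borel_measurable (lborel \<Otimes>\<^sub>M N)" and H_le: "\<And>u \<nu>. cmod (H u \<nu>) \<le> 2 * B"
      and cov: "\<And>u w. (\<integral>\<nu>. H u \<nu> * cnj (H w \<nu>) \<partial>N) = (\<integral>\<omega>. D u \<omega> * cnj (D w \<omega>) \<partial>M)" for H
  proof -
    have [measurable]: "H u \<in> borel_measurable N" for u
      using measurable_compose[OF measurable_Pair1' H_meas, of u] by simp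
    have sq_le: "(cmod (H u \<nu>))\<^sup>2 \<le> (2 * B)\<^sup>2" for u \<nu> using H_le by (intro power_mono) auto
    have i: "integrable N (\<lambda>\<nu>. (cmod (H u \<nu>))\<^sup>2)" for u
      by (rule N.integrable_const_bound[where B = "(2 * B)\<^sup>2"]) (use sq_le in auto)
    have k: "(\<integral>\<nu>. (cmod (H u \<nu>))\<^sup>2 \<partial>N) \<le> (\<integral>\<nu>. (2 * B)\<^sup>2 \<partial>N)" for u
      using i sq_le by (intro integral_mono) auto
    note h = second_moment_of_integral[OF fin H_meas i k f]
    show "integrable N (\<lambda>\<nu>. (cmod (LBINT u. H u \<nu> * f u))\<^sup>2)" by (rule h(3))
    have "complex_of_real (\<integral>\<nu>. (cmod (LBINT u. H u \<nu> * f u))\<^sup>2 \<partial>N) = of_real (\<integral>\<omega>. (cmod (LBINT u. D u \<omega> * f u))\<^sup>2 \<partial>M)"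
      unfolding h(4) sm(4) cov ..
    then show "(\<integral>\<nu>. (cmod (LBINT u. H u \<nu> * f u))\<^sup>2 \<partial>N) = (\<integral>\<omega>. (cmod (LBINT u. D u \<omega> * f u))\<^sup>2 \<partial>M)"
      by (simp only: of_real_eq_iff)
  qed
  have [measurable]: "(\<lambda>x. G (fst x) (snd x)) \<in> borel_measurable (lborel \<Otimes>\<^sub>M N)"
    unfolding G by measurable
  have G_meas: "(\<lambda>(u, \<nu>). G u \<nu>) \<in> borel_measurable (lborel \<Otimes>\<^sub>M N)"
    "(\<lambda>(u, \<nu>). cnj (G u \<nu>)) \<in> borel_measurable (lborel \<Otimes>\<^sub>M N)"
    unfolding split_beta' by measurable
  have cov_cnj: "(\<integral>\<nu>. cnj (G u \<nu>) * cnj (cnj (G w \<nu>)) \<partial>N) = (\<integral>\<omega>. D u \<omega> * cnj (D w \<omega>) \<partial>M)" for u w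
  proof -
    have "(\<integral>\<nu>. cnj (G u \<nu>) * cnj (cnj (G w \<nu>)) \<partial>N) = cnj (\<integral>\<nu>. G u \<nu> * cnj (G w \<nu>) \<partial>N)"
      by (simp only: Bochner_Integration.integral_cnj[symmetric] complex_cnj_mult)
    then show ?thesis by (simp only: covG cnj_DD)
  qed
  note G1 = smN[OF G_meas(1) G_le covG]
  note G2 = smN[of "\<lambda>u \<nu>. cnj (G u \<nu>)", OF G_meas(2) _ cov_cnj, unfolded complex_mod_cnj, OF G_le]
  let ?h = "\<lambda>\<nu>. (cmod (LBINT u. G u \<nu> * f u))\<^sup>2 + (cmod (LBINT u. cnj (G u \<nu>) * f u))\<^sup>2"
  have h_int: "integrable N ?h" using G1(1) G2(1) by (rule Bochner_Integration.integrable_add)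
  then have h_meas: "?h \<in> borel_measurable lborel"
    using borel_measurable_integrable[OF h_int] sets_N by (simp cong: measurable_cong_sets)
  show "integrable lborel (\<lambda>\<nu>. S \<nu> * ?h \<nu>)"
    using h_int unfolding N_def by (subst (asm) integrable_real_density) (use S0 h_meas in auto)
  have "(LBINT \<nu>. S \<nu> * ?h \<nu>) = (\<integral>\<nu>. ?h \<nu> \<partial>N)"
    unfolding N_def by (subst integral_real_density) (use S0 h_meas in auto)
  also have "\<dots> = 2 * (\<integral>\<omega>. (cmod (LBINT u. D u \<omega> * f u))\<^sup>2 \<partial>M)"
    using G1 G2 by simp
  finally show "(\<integral>\<omega>. (cmod (LBINT u. D u \<omega> * f u))\<^sup>2 \<partial>M) = (LBINT \<nu>. S \<nu> * ?h \<nu>) / 2" by simp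
qed

text \<open>The Jacobian \<open>q powr s\<close> against the normalisation
  \<open>q powr (- s / 2)\<close> leaves \<open>q powr (s / 2)\<close>.\<close>

lemma wavelet_rescale:
  assumes "0 < q"
  shows "wavelet q \<psi> Z s \<tau> \<omega> = of_real (q powr (s / 2)) * (LBINT u. of_real (Z (\<tau> + q powr s * u) \<omega>) * cnj (\<psi> u))"
proof -
  have Q: "0 < q powr s" using assms by simp
  have psi: "psi_st q \<psi> s \<tau> (\<tau> + q powr s * u) = of_real (q powr (- s / 2)) * \<psi> u" for u
  proof -
    have "q powr (- s) * (q powr s * u) = u" using assms by (simp add: powr_minus)
    then show ?thesis unfolding psi_st_def by (simp only: add_diff_cancel_left')
  qed
  have "wavelet q \<psi> Z s \<tau> \<omega>
      = q powr s *\<^sub>R (LBINT u. of_real (Z (\<tau> + q powr s * u) \<omega>) * cnj (psi_st q \<psi> s \<tau> (\<tau> + q powr s * u)))"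
    unfolding wavelet_def using Q
    by (subst lborel_integral_real_affine[of "q powr s" _ \<tau>]) simp_all
  also have "\<dots> = q powr s *\<^sub>R (LBINT u. of_real (Z (\<tau> + q powr s * u) \<omega>) * cnj (of_real (q powr (- s / 2)) * \<psi> u))"
    unfolding psi ..
  also have "(LBINT u. of_real (Z (\<tau> + q powr s * u) \<omega>) * cnj (of_real (q powr (- s / 2)) * \<psi> u))
      = of_real (q powr (- s / 2)) * (LBINT u. of_real (Z (\<tau> + q powr s * u) \<omega>) * cnj (\<psi> u))"
    by (subst integral_mult_right_zero[symmetric]) (simp add: mult_ac)
  finally have "wavelet q \<psi> Z s \<tau> \<omega>
      = of_real (q powr s * q powr (- s / 2)) * (LBINT u. of_real (Z (\<tau> + q powr s * u) \<omega>) * cnj (\<psi> u))"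
    by (simp add: scaleR_conv_of_real)
  also have "q powr s * q powr (- s / 2) = q powr (s / 2)" by (simp flip: powr_add)
  finally show ?thesis .
qed

subsection \<open>The error bound\<close>

text \<open>Joint measurability of \<open>X\<close> gives meaning to integrals along paths, and
  \<open>q \<noteq> 1\<close> makes \<open>log q\<close> invert the power. For the continuous
  functions \<open>\<gamma>''\<close> and \<open>a'\<close> the real supremum of the modulus is the
  essential supremum. It is meaningful only for bounded functions, so the estimate is asserted for
  finite norms, and the second order property always.\<close>

theorem theorem1:
  fixes M :: "'a measure" and X :: "real \<Rightarrow> 'a \<Rightarrow> real" and S :: "real \<Rightarrow> real"
    and a a' \<gamma> \<gamma>' \<gamma>'' :: "real \<Rightarrow> real" and \<psi> :: "real \<Rightarrow> complex"
    and c_a C_a c_\<gamma> C_\<gamma> \<beta> q :: real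
  assumes M: "prob_space M"
    and X_rv: "\<And>t. X t \<in> borel_measurable M"
    and X_joint: "(\<lambda>(t, \<omega>). X t \<omega>) \<in> borel_measurable (lborel \<Otimes>\<^sub>M M)"
    and X_2nd: "\<And>t. integrable M (\<lambda>\<omega>. (X t \<omega>)\<^sup>2)"
    and X_mean: "\<And>t. integral\<^sup>L M (X t) = 0"
    and S_nonneg: "\<And>\<nu>. S \<nu> \<ge> 0"
    and S_meas: "S \<in> borel_measurable lborel"
    and S_int: "integrable lborel S"
    and X_cov: "\<And>t s. complex_of_real (integral\<^sup>L M (\<lambda>\<omega>. X t \<omega> * X s \<omega>)) =
                  integral\<^sup>L lborel (\<lambda>\<nu>. complex_of_real (S \<nu>) * exp (2 * pi * \<i> * \<nu> * (t - s)))"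
    and a_deriv: "\<And>t. (a has_real_derivative a' t) (at t)"
    and a'_cont: "continuous_on UNIV a'"
    and a_bounds: "0 < c_a" "\<And>t. c_a \<le> a t" "\<And>t. a t \<le> C_a"
    and g_deriv: "\<And>t. (\<gamma> has_real_derivative \<gamma>' t) (at t)"
    and g'_deriv: "\<And>t. (\<gamma>' has_real_derivative \<gamma>'' t) (at t)"
    and g''_cont: "continuous_on UNIV \<gamma>''"
    and g_mono: "strict_mono \<gamma>"
    and g_bounds: "0 < c_\<gamma>" "\<And>t. c_\<gamma> \<le> \<gamma>' t" "\<And>t. \<gamma>' t \<le> C_\<gamma>"
    and psi_H2: "H2 \<psi>"
    and psi_smooth: "smooth_fun \<psi>"
    and beta: "\<beta> > 2"
    and psi_decay: "\<And>t. cmod (\<psi> t) \<le> 1 / (1 + \<bar>t\<bar> powr \<beta>)"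
    and q: "q > 0" "q \<noteq> 1"
    and I_fin: "set_integrable lborel {0<..}
                  (\<lambda>\<xi>. \<xi> powr (2 * ((\<beta> - 1) / (\<beta> + 2))) * S \<xi>)"
  shows
    "let \<sigma> = sqrt (integral\<^sup>L M (\<lambda>\<omega>. (X 0 \<omega>)\<^sup>2));
         \<rho> = (\<beta> - 1) / (\<beta> + 2);
         \<mu> = (\<beta> - 4) / (\<beta> + 2);
         I = sqrt (LBINT \<xi>:{0<..}. \<xi> powr (2 * \<rho>) * S \<xi>);
         Y = (\<lambda>t \<omega>. a t * sqrt (\<gamma>' t) * X (\<gamma> t) \<omega>);
         \<epsilon> = (\<lambda>s \<tau> \<omega>. wavelet q \<psi> Y s \<tau> \<omega>
                 - complex_of_real (a \<tau>) * wavelet q \<psi> X (s + log q (\<gamma>' \<tau>)) (\<gamma> \<tau>) \<omega>);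
         K1 = \<beta> * \<sigma> / (2 * (\<beta> - 2) * sqrt c_\<gamma>);
         K2 = I * (pi / 2) powr \<rho> * sqrt C_\<gamma> * (4 / (3 * \<rho>));
         K3 = sqrt C_\<gamma> * \<beta> * \<sigma> / ((\<beta> - 2) * c_a);
         N2 = (SUP t. \<bar>\<gamma>'' t\<bar>);
         N1 = (SUP t. \<bar>a' t\<bar>)
     in \<forall>s \<tau>. \<epsilon> s \<tau> \<in> borel_measurable M
            \<and> integrable M (\<lambda>\<omega>. (cmod (\<epsilon> s \<tau> \<omega>))\<^sup>2)
            \<and> (bounded (range \<gamma>'') \<and> bounded (range a') \<longrightarrow>
                integral\<^sup>L M (\<lambda>\<omega>. (cmod (\<epsilon> s \<tau> \<omega>))\<^sup>2)
                  \<le> C_a\<^sup>2 * q powr (3 * s) * (K1 * N2 + K2 * q powr (\<mu> * s) * N2 powr \<rho> + K3 * N1)\<^sup>2)"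
proof -
  interpret prob_space M by (rule M)
  define \<sigma> where "\<sigma> = sqrt (\<integral>\<omega>. (X 0 \<omega>)\<^sup>2 \<partial>M)"
  define \<rho> where "\<rho> = (\<beta> - 1) / (\<beta> + 2)"
  define \<mu> where "\<mu> = (\<beta> - 4) / (\<beta> + 2)"
  define I where "I = sqrt (LBINT \<xi>:{0<..}. \<xi> powr (2 * \<rho>) * S \<xi>)"
  define Y where "Y = (\<lambda>t \<omega>. a t * sqrt (\<gamma>' t) * X (\<gamma> t) \<omega>)"
  define \<epsilon> where "\<epsilon> = (\<lambda>s \<tau> \<omega>. wavelet q \<psi> Y s \<tau> \<omega>
    - complex_of_real (a \<tau>) * wavelet q \<psi> X (s + log q (\<gamma>' \<tau>)) (\<gamma> \<tau>) \<omega>)"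
  define K1 where "K1 = \<beta> * \<sigma> / (2 * (\<beta> - 2) * sqrt c_\<gamma>)"
  define K2 where "K2 = I * (pi / 2) powr \<rho> * sqrt C_\<gamma> * (4 / (3 * \<rho>))"
  define K3 where "K3 = sqrt C_\<gamma> * \<beta> * \<sigma> / ((\<beta> - 2) * c_a)"
  define N2 where "N2 = (SUP t. \<bar>\<gamma>'' t\<bar>)"
  define N1 where "N1 = (SUP t. \<bar>a' t\<bar>)"
  have \<rho>: "0 < \<rho>" using beta by (simp add: \<rho>_def)
  have [measurable]: "S \<in> borel_measurable borel" using S_meas by simp
  have C_\<gamma>: "0 < C_\<gamma>" and C_a: "0 < C_a" "c_a \<le> C_a"
    using g_bounds(1) g_bounds(2,3)[of 0] a_bounds(1) a_bounds(2,3)[of 0] by linarith+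
  have cov: "complex_of_real (\<integral>\<omega>. X t \<omega> * X s \<omega> \<partial>M)
      = (LBINT \<nu>. of_real (S \<nu>) * exp (\<i> * of_real (2 * pi * \<nu> * (t - s))))" for t s
  proof -
    have "exp (complex_of_real (2 * pi) * \<i> * complex_of_real \<nu> * (complex_of_real t - complex_of_real s)) = exp (\<i> * of_real (2 * pi * \<nu> * (t - s)))" for \<nu> :: real
      by (rule arg_cong[where f = exp]) simp
    then show ?thesis unfolding X_cov by presburger
  qed
  have S_sigma: "(LBINT x. S x) = \<sigma>\<^sup>2"
    using cov[of 0 0] Bochner_Integration.integral_nonneg[of lborel S] S_nonneg by (simp add: \<sigma>_def power2_eq_square[symmetric])
  have \<sigma>0: "0 \<le> \<sigma>" by (simp add: \<sigma>_def)
  \<comment> \<open>\<open>I\<close> sees positive frequencies only, whereas the spectral formula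
    uses both half lines. The process being real, its covariance is real, and the lag
    \<open>t / (2 * pi)\<close> turns it into the Fourier integral of \<open>S\<close> at
    \<open>t\<close>.\<close>
  have even: "AE x in lborel. S (- x) = S x"
  proof (rule even_of_real_fourier[OF S_nonneg S_int])
    fix t :: real
    have "(LBINT x. of_real (S x) * exp (\<i> * of_real (t * x)))
        = complex_of_real (\<integral>\<omega>. X (t / (2 * pi)) \<omega> * X 0 \<omega> \<partial>M)"
    proof -
      have "2 * pi * x * (t / (2 * pi) - 0) = t * x" for x :: real by simp
      then show ?thesis unfolding cov by presburger
    qed
    then show "(LBINT x. of_real (S x) * exp (\<i> * of_real (t * x))) \<in> \<real>" by simp
  qed
  have S_rho: "integrable lborel (\<lambda>x. \<bar>x\<bar> powr (2 * \<rho>) * S x)"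
    and I_sq: "(LBINT x. \<bar>x\<bar> powr (2 * \<rho>) * S x) = 2 * I\<^sup>2" and I0: "0 \<le> I"
  proof -
    define h where "h = (\<lambda>x. indicat_real {0<..} x * (x powr (2 * \<rho>) * S x))"
    have h: "integrable lborel h" using I_fin by (simp add: h_def set_integrable_def \<rho>_def)
    have h': "integrable lborel (\<lambda>x. h (- x))" using lborel_integrable_real_affine[OF h, of "- 1" 0] by simp
    have [measurable]: "h \<in> borel_measurable borel" unfolding h_def by measurable
    have eq: "AE x in lborel. h x + h (- x) = \<bar>x\<bar> powr (2 * \<rho>) * S x"
      using even AE_lborel_singleton[of 0] by eventually_elim (auto simp: h_def indicator_def)
    show "integrable lborel (\<lambda>x. \<bar>x\<bar> powr (2 * \<rho>) * S x)"
      by (rule integrable_cong_AE_imp[OF Bochner_Integration.integrable_add[OF h h'] _ eq]) measurable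
    have nonneg: "0 \<le> (LBINT x. h x)" using S_nonneg by (simp add: h_def)
    have I2: "I\<^sup>2 = (LBINT x. h x)"
      using nonneg by (simp add: I_def set_lebesgue_integral_def h_def)
    have "(LBINT x. \<bar>x\<bar> powr (2 * \<rho>) * S x) = (LBINT x. h x + h (- x))"
      using eq by (intro integral_cong_AE) (auto elim: AE_mp)
    also have "\<dots> = 2 * I\<^sup>2"
      using h h' lborel_integral_real_affine[of "- 1" h 0] I2 by simp
    finally show "(LBINT x. \<bar>x\<bar> powr (2 * \<rho>) * S x) = 2 * I\<^sup>2" .
    show "0 \<le> I" using nonneg by (simp add: I_def set_lebesgue_integral_def h_def)
  qed
  have cont: "continuous_on UNIV a" "continuous_on UNIV \<gamma>" "continuous_on UNIV \<gamma>'"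
    using a_deriv g_deriv g'_deriv by (meson DERIV_isCont continuous_at_imp_continuous_on)+
  have [measurable]: "a \<in> borel_measurable borel" "\<gamma> \<in> borel_measurable borel" "\<gamma>' \<in> borel_measurable borel"
    using cont by (auto intro: borel_measurable_continuous_onI)
  have g'_pos: "0 < \<gamma>' t" for t using g_bounds(1) g_bounds(2)[of t] by simp
  have [measurable]: "\<psi> \<in> borel_measurable borel" using psi_H2 by (simp add: H2_def)
  define f where "f = (\<lambda>u. cnj (\<psi> u))"
  have f_meas [measurable]: "f \<in> borel_measurable borel" unfolding f_def by measurable
  have f_le: "cmod (f u) \<le> envelope \<beta> u" for u
    using psi_decay[of u] by (simp add: f_def envelope_def)
  have f_int: "integrable lborel f"
    by (rule Bochner_Integration.integrable_bound[OF envelope_integrable[of \<beta>]])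
      (use beta f_le in \<open>auto intro: order_trans[OF _ abs_ge_self]\<close>)
  have sqrt_g: "sqrt c_\<gamma> \<le> sqrt (\<gamma>' t)" "sqrt (\<gamma>' t) \<le> sqrt C_\<gamma>" for t
    using g_bounds(2,3)[of t] by simp_all
  have field: "\<epsilon> s \<tau> \<in> borel_measurable M \<and> integrable M (\<lambda>\<omega>. (cmod (\<epsilon> s \<tau> \<omega>))\<^sup>2) \<and>
      (bounded (range \<gamma>'') \<and> bounded (range a') \<longrightarrow>
        (\<integral>\<omega>. (cmod (\<epsilon> s \<tau> \<omega>))\<^sup>2 \<partial>M)
          \<le> C_a\<^sup>2 * q powr (3 * s) * (K1 * N2 + K2 * q powr (\<mu> * s) * N2 powr \<rho> + K3 * N1)\<^sup>2)" for s \<tau>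
  proof -
    \<comment> \<open>In the rescaled variable the second transform has scale
      \<open>Q * \<gamma>' \<tau>\<close>, whose square root supplies the amplitude
      \<open>sqrt (\<gamma>' \<tau>)\<close>. So both terms have the same form, and the
      approximation replaces \<gamma> by its tangent line at \<tau> and freezes both
      amplitudes.\<close>
    define Q where "Q = q powr s"
    have Q: "0 < Q" using q by (simp add: Q_def)
    define c\<^sub>1 where "c\<^sub>1 = (\<lambda>u. a (\<tau> + Q * u) * sqrt (\<gamma>' (\<tau> + Q * u)))"
    define c\<^sub>2 where "c\<^sub>2 = (\<lambda>u::real. a \<tau> * sqrt (\<gamma>' \<tau>))"
    define g\<^sub>1 where "g\<^sub>1 = (\<lambda>u. \<gamma> (\<tau> + Q * u))"
    define g\<^sub>2 where "g\<^sub>2 = (\<lambda>u. \<gamma> \<tau> + \<gamma>' \<tau> * Q * u)"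
    define D where "D = (\<lambda>u \<omega>. complex_of_real (c\<^sub>1 u * X (g\<^sub>1 u) \<omega> - c\<^sub>2 u * X (g\<^sub>2 u) \<omega>))"
    define G where "G = (\<lambda>u \<nu>. of_real (c\<^sub>1 u) * exp (\<i> * of_real (2 * pi * \<nu> * g\<^sub>1 u))
      - of_real (c\<^sub>2 u) * exp (\<i> * of_real (2 * pi * \<nu> * g\<^sub>2 u)))"
    define h where "h = (\<lambda>\<nu>. (cmod (LBINT u. G u \<nu> * f u))\<^sup>2 + (cmod (LBINT u. cnj (G u \<nu>) * f u))\<^sup>2)"
    have m [measurable]: "c\<^sub>1 \<in> borel_measurable borel" "c\<^sub>2 \<in> borel_measurable borel"
        "g\<^sub>1 \<in> borel_measurable borel" "g\<^sub>2 \<in> borel_measurable borel"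
      unfolding c\<^sub>1_def c\<^sub>2_def g\<^sub>1_def g\<^sub>2_def by measurable
    have amp: "\<bar>a t * sqrt (\<gamma>' t)\<bar> \<le> C_a * sqrt C_\<gamma>" for t
      using a_bounds(1) a_bounds(2,3)[of t] sqrt_g(2)[of t] g'_pos[of t] C_\<gamma> C_a
      by (auto simp: abs_mult intro!: mult_mono)
    have c_le: "\<bar>c\<^sub>1 u\<bar> \<le> C_a * sqrt C_\<gamma>" "\<bar>c\<^sub>2 u\<bar> \<le> C_a * sqrt C_\<gamma>" "\<bar>0\<bar> \<le> C_a * sqrt C_\<gamma>" for u
      unfolding c\<^sub>1_def c\<^sub>2_def using amp C_a C_\<gamma> by simp_all
    note SR = spectral_representation[OF M X_rv X_joint X_2nd S_nonneg S_int cov _ _ _ _ _ _ f_int]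
    note R = SR[OF m c_le(1,2)]
    \<comment> \<open>Setting one amplitude to 0 yields almost sure integrability of each transform
      separately, which is needed to split the integral of the difference.\<close>
    note R1 = SR[of c\<^sub>1 "\<lambda>u. 0" g\<^sub>1 g\<^sub>1 "C_a * sqrt C_\<gamma>"]
    note R2 = SR[of c\<^sub>2 "\<lambda>u. 0" g\<^sub>2 g\<^sub>2 "C_a * sqrt C_\<gamma>"]
    define E1 where "E1 = (\<lambda>\<omega>. LBINT u. complex_of_real (c\<^sub>1 u * X (g\<^sub>1 u) \<omega>) * f u)"
    define E2 where "E2 = (\<lambda>\<omega>. LBINT u. complex_of_real (c\<^sub>2 u * X (g\<^sub>2 u) \<omega>) * f u)"
    have E_meas [measurable]: "E1 \<in> borel_measurable M" "E2 \<in> borel_measurable M"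
      using R1(1) R2(1) c_le unfolding E1_def E2_def by simp_all
    have E_int: "AE \<omega> in M. integrable lborel (\<lambda>u. complex_of_real (c\<^sub>1 u * X (g\<^sub>1 u) \<omega>) * f u)"
        "AE \<omega> in M. integrable lborel (\<lambda>u. complex_of_real (c\<^sub>2 u * X (g\<^sub>2 u) \<omega>) * f u)"
      using R1(2) R2(2) c_le by simp_all
    have sqrt_q: "q powr (x / 2) = sqrt (q powr x)" for x
      using powr_half_sqrt[of "q powr x"] by (simp add: powr_powr)
    have q_log: "q powr (s + log q (\<gamma>' \<tau>)) = Q * \<gamma>' \<tau>"
      using q g'_pos[of \<tau>] by (simp add: powr_add Q_def)
    have \<epsilon>_eq: "\<epsilon> s \<tau> \<omega> = of_real (sqrt Q) * (E1 \<omega> - E2 \<omega>)" for \<omega>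
    proof -
      have "wavelet q \<psi> Y s \<tau> \<omega> = of_real (sqrt Q) * E1 \<omega>"
        unfolding wavelet_rescale[OF q(1)] sqrt_q
        by (simp add: E1_def Y_def c\<^sub>1_def g\<^sub>1_def f_def Q_def)
      moreover have "of_real (a \<tau>) * wavelet q \<psi> X (s + log q (\<gamma>' \<tau>)) (\<gamma> \<tau>) \<omega> = of_real (sqrt Q) * E2 \<omega>"
      proof -
        have "E2 \<omega> = of_real (a \<tau> * sqrt (\<gamma>' \<tau>)) * (LBINT u. of_real (X (\<gamma> \<tau> + Q * \<gamma>' \<tau> * u) \<omega>) * f u)"
          unfolding E2_def c\<^sub>2_def g\<^sub>2_def by (subst integral_mult_right_zero[symmetric]) (simp add: mult_ac)
        then show ?thesis
          unfolding wavelet_rescale[OF q(1)] sqrt_q q_log by (simp add: real_sqrt_mult f_def mult_ac)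
      qed
      ultimately show ?thesis by (simp add: \<epsilon>_def right_diff_distrib)
    qed
    have AE_eq: "AE \<omega> in M. Q * (cmod (LBINT u. D u \<omega> * f u))\<^sup>2 = (cmod (\<epsilon> s \<tau> \<omega>))\<^sup>2"
      using E_int
    proof eventually_elim
      case (elim \<omega>)
      have "(LBINT u. D u \<omega> * f u) = E1 \<omega> - E2 \<omega>"
        unfolding E1_def E2_def D_def
        by (subst Bochner_Integration.integral_diff[symmetric]) (use elim in \<open>auto simp: left_diff_distrib\<close>)
      then show ?case using Q by (simp add: \<epsilon>_eq norm_mult power_mult_distrib)
    qed
    \<comment> \<open>\<open>M\<close> need not be complete, so measurability is taken from the
      pointwise formula and not from the almost sure identity.\<close>
    have \<epsilon>_meas [measurable]: "\<epsilon> s \<tau> \<in> borel_measurable M"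
      unfolding \<epsilon>_eq[abs_def] by measurable
    have D_int: "integrable M (\<lambda>\<omega>. Q * (cmod (LBINT u. D u \<omega> * f u))\<^sup>2)"
      unfolding D_def using R(3) by (rule integrable_mult_right)
    have \<epsilon>_int: "integrable M (\<lambda>\<omega>. (cmod (\<epsilon> s \<tau> \<omega>))\<^sup>2)"
      by (rule integrable_cong_AE_imp[OF D_int _ AE_eq]) measurable
    have "(\<integral>\<omega>. (cmod (\<epsilon> s \<tau> \<omega>))\<^sup>2 \<partial>M) = (\<integral>\<omega>. Q * (cmod (LBINT u. D u \<omega> * f u))\<^sup>2 \<partial>M)"
      by (rule integral_cong_AE[OF _ borel_measurable_integrable[OF D_int]])
        (measurable, use AE_eq in eventually_elim, simp)
    also have "\<dots> = Q * ((LBINT \<nu>. S \<nu> * h \<nu>) / 2)"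
      unfolding integral_mult_right_zero D_def R(5) h_def G_def ..
    finally have energy: "(\<integral>\<omega>. (cmod (\<epsilon> s \<tau> \<omega>))\<^sup>2 \<partial>M) = Q * ((LBINT \<nu>. S \<nu> * h \<nu>) / 2)" .
    have h_int: "integrable lborel (\<lambda>\<nu>. S \<nu> * h \<nu>)"
      unfolding h_def G_def by (rule R(4))
    have "(\<integral>\<omega>. (cmod (\<epsilon> s \<tau> \<omega>))\<^sup>2 \<partial>M)
          \<le> C_a\<^sup>2 * q powr (3 * s) * (K1 * N2 + K2 * q powr (\<mu> * s) * N2 powr \<rho> + K3 * N1)\<^sup>2"
      if bdd: "bounded (range \<gamma>'')" "bounded (range a')"
    proof -
      have bdd_abs: "\<bar>F t\<bar> \<le> (SUP t. \<bar>F t\<bar>)" if "bounded (range F)" for F :: "real \<Rightarrow> real" and t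
      proof -
        obtain B where "\<And>t. \<bar>F t\<bar> \<le> B" using \<open>bounded (range F)\<close> by (auto simp: bounded_iff)
        then have "bdd_above (range (\<lambda>t. \<bar>F t\<bar>))" by (auto intro!: bdd_aboveI[where M = B])
        then show ?thesis by (intro cSUP_upper) auto
      qed
      have N2: "\<bar>\<gamma>'' t\<bar> \<le> N2" and N1: "\<bar>a' t\<bar> \<le> N1" for t
        unfolding N1_def N2_def by (rule bdd_abs[OF bdd(1)], rule bdd_abs[OF bdd(2)])
      have N0: "0 \<le> N2" "0 \<le> N1" using N2[of 0] N1[of 0] by linarith+
      have lip: "\<bar>F (\<tau> + Q * u) - F \<tau>\<bar> \<le> Q * N * \<bar>u\<bar>"
        if "\<And>t. (F has_real_derivative F' t) (at t)" "\<And>t. \<bar>F' t\<bar> \<le> N" for F F' N u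
      proof -
        have "norm (F (\<tau> + Q * u) - F \<tau>) \<le> N * norm ((\<tau> + Q * u) - \<tau>)"
          by (rule field_differentiable_bound[where S = UNIV and f' = F']) (use that in auto)
        then show ?thesis using Q by (simp add: abs_mult mult_ac)
      qed
      define m where "m = \<beta> / (\<beta> - 2)"
      \<comment> \<open>\<open>\<kappa> * \<sigma>\<close> will give the \<open>K1\<close> and
        \<open>K3\<close> terms, \<open>J * I\<close> the \<open>K2\<close> term. The base in
        \<open>J\<close> is \<open>l * n / 4\<close> for \<open>l = 2 * pi * \<nu> * Q\<close> and
        \<open>n = Q * N2\<close>, with the frequency taken out.\<close>
      define \<kappa> where "\<kappa> = (Q * N1 * sqrt C_\<gamma> + C_a * (Q * N2 / (2 * sqrt c_\<gamma>))) * m"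
      define J where "J = C_a * sqrt C_\<gamma> * (4 / (3 * \<rho>) * (pi * Q\<^sup>2 * N2 / 2) powr \<rho>)"
      have m: "0 < m" using beta by (simp add: m_def)
      have \<kappa>0: "0 \<le> \<kappa>" unfolding \<kappa>_def using m N0 Q C_\<gamma> C_a g_bounds(1)
        by (intro mult_nonneg_nonneg add_nonneg_nonneg divide_nonneg_nonneg) auto
      have J0: "0 \<le> J" unfolding J_def using C_\<gamma> C_a \<rho> by simp
      \<comment> \<open>The single-frequency bound requires a positive \<open>l\<close>, hence a
        positive frequency. Negative ones follow by symmetry, and frequency 0 is null.\<close>
      have h_pos: "h \<nu> \<le> (sqrt 2 * \<kappa> + J * \<bar>\<nu>\<bar> powr \<rho>)\<^sup>2" if \<nu>: "0 < \<nu>" for \<nu>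
      proof -
        define \<alpha> where "\<alpha> = (\<lambda>u. sqrt (\<gamma>' (\<tau> + Q * u)))"
        define \<Gamma> where "\<Gamma> = (\<lambda>u. 2 * pi * \<nu> * (\<gamma> (\<tau> + Q * u) - \<gamma> \<tau>))"
        define a\<^sub>u where "a\<^sub>u = (\<lambda>u. a (\<tau> + Q * u))"
        define l where "l = 2 * pi * \<nu> * Q"
        define b where "b = sqrt (\<gamma>' \<tau>)"
        define H where "H = (\<lambda>u. of_real (a\<^sub>u u * \<alpha> u) * exp (\<i> * of_real (\<Gamma> u)) - of_real (a\<^sub>u 0 * b) * exp (\<i> * of_real (l * b\<^sup>2 * u)))"
        have \<alpha>2: "(\<alpha> u)\<^sup>2 = \<gamma>' (\<tau> + Q * u)" for u using g'_pos[of "\<tau> + Q * u"] by (simp add: \<alpha>_def)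
        have b2: "b\<^sup>2 = \<gamma>' \<tau>" using g'_pos[of \<tau>] by (simp add: b_def)
        have fb: "(cmod (LBINT u. H u * f u))\<^sup>2 + (cmod (LBINT u. cnj (H u) * f u))\<^sup>2
            \<le> (sqrt 2 * (Q * N1 * sqrt C_\<gamma> + \<bar>a\<^sub>u 0\<bar> * (Q * N2 / (2 * sqrt c_\<gamma>))) * (\<beta> / (\<beta> - 2))
              + \<bar>a\<^sub>u 0\<bar> * sqrt C_\<gamma> * (4 / (3 * ((\<beta> - 1) / (\<beta> + 2))) * (l * (Q * N2) / 4) powr ((\<beta> - 1) / (\<beta> + 2))))\<^sup>2"
          unfolding H_def
        proof (rule frequency_bound[OF beta])
          show "continuous_on UNIV \<alpha>" "continuous_on UNIV a\<^sub>u"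
            unfolding \<alpha>_def a\<^sub>u_def
            by (auto intro!: continuous_intros continuous_on_compose2[OF cont(3)] continuous_on_compose2[OF cont(1)])
          show "\<bar>(\<alpha> u)\<^sup>2 - b\<^sup>2\<bar> \<le> Q * N2 * \<bar>u\<bar>" for u
            unfolding \<alpha>2 b2 by (rule lip[OF g'_deriv N2])
          show "\<bar>a\<^sub>u u - a\<^sub>u 0\<bar> \<le> Q * N1 * \<bar>u\<bar>" for u
            unfolding a\<^sub>u_def using lip[OF a_deriv N1, of u] by simp
          show "(\<Gamma> has_real_derivative l * (\<alpha> u)\<^sup>2) (at u)" for u
          proof -
            have "((\<lambda>u. \<gamma> (\<tau> + Q * u)) has_real_derivative \<gamma>' (\<tau> + Q * u) * Q) (at u)"
              by (rule DERIV_chain2[OF g_deriv]) (auto intro!: derivative_eq_intros)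
            from DERIV_cmult[OF DERIV_diff[OF this DERIV_const[of "\<gamma> \<tau>"]], of "2 * pi * \<nu>"]
            show ?thesis unfolding \<Gamma>_def \<alpha>2 l_def by (simp add: mult_ac)
          qed
        qed (use \<nu> Q g_bounds(1) N0 f_le sqrt_g in \<open>auto simp: l_def \<alpha>_def b_def \<Gamma>_def\<close>)
        \<comment> \<open>\<Gamma> is normalised to vanish at 0; the phase taken out does not depend
          on \<open>u\<close> and has modulus 1.\<close>
        have G_H: "G u \<nu> = exp (\<i> * of_real (2 * pi * \<nu> * \<gamma> \<tau>)) * H u" for u
        proof -
          have "\<i> * of_real (2 * pi * \<nu> * g\<^sub>1 u) = \<i> * of_real (2 * pi * \<nu> * \<gamma> \<tau>) + \<i> * complex_of_real (\<Gamma> u)"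
            "\<i> * of_real (2 * pi * \<nu> * g\<^sub>2 u) = \<i> * of_real (2 * pi * \<nu> * \<gamma> \<tau>) + \<i> * complex_of_real (l * b\<^sup>2 * u)"
            unfolding g\<^sub>1_def g\<^sub>2_def \<Gamma>_def l_def b2 by (simp_all add: algebra_simps)
          then show ?thesis
            unfolding G_def H_def by (simp only: exp_add) (simp add: c\<^sub>1_def c\<^sub>2_def a\<^sub>u_def \<alpha>_def b_def algebra_simps)
        qed
        have 1: "cmod (LBINT u. G u \<nu> * f u) = cmod (LBINT u. H u * f u)"
          unfolding G_H mult.assoc integral_mult_right_zero norm_mult norm_exp_i_times by simp
        have 2: "cmod (LBINT u. cnj (G u \<nu>) * f u) = cmod (LBINT u. cnj (H u) * f u)"
          unfolding G_H complex_cnj_mult mult.assoc integral_mult_right_zero norm_mult complex_mod_cnj norm_exp_i_times by simp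
        have au: "\<bar>a\<^sub>u 0\<bar> \<le> C_a"
          using a_bounds(1) a_bounds(2,3)[of \<tau>] by (simp add: a\<^sub>u_def)
        have ln: "(l * (Q * N2) / 4) powr \<rho> = (pi * Q\<^sup>2 * N2 / 2) powr \<rho> * \<nu> powr \<rho>"
        proof -
          have "l * (Q * N2) / 4 = (pi * Q\<^sup>2 * N2 / 2) * \<nu>" by (simp add: l_def power2_eq_square)
          then show ?thesis using N0 \<nu> by (simp only: powr_mult)
        qed
        have "sqrt 2 * (Q * N1 * sqrt C_\<gamma> + \<bar>a\<^sub>u 0\<bar> * (Q * N2 / (2 * sqrt c_\<gamma>))) * m \<le> sqrt 2 * \<kappa>"
          unfolding \<kappa>_def mult.assoc[of "sqrt 2"] using au m N0 Q g_bounds(1)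
          by (intro mult_left_mono mult_right_mono add_left_mono) auto
        moreover have "\<bar>a\<^sub>u 0\<bar> * sqrt C_\<gamma> * (4 / (3 * \<rho>) * (l * (Q * N2) / 4) powr \<rho>) \<le> J * \<bar>\<nu>\<bar> powr \<rho>"
        proof -
          have "\<bar>a\<^sub>u 0\<bar> * (sqrt C_\<gamma> * (4 / (3 * \<rho>) * ((pi * Q\<^sup>2 * N2 / 2) powr \<rho> * \<nu> powr \<rho>)))
              \<le> C_a * (sqrt C_\<gamma> * (4 / (3 * \<rho>) * ((pi * Q\<^sup>2 * N2 / 2) powr \<rho> * \<nu> powr \<rho>)))"
            using au C_\<gamma> \<rho> by (intro mult_right_mono) auto
          then show ?thesis using \<nu> unfolding ln J_def by (simp add: mult_ac)
        qed
        ultimately have "sqrt 2 * (Q * N1 * sqrt C_\<gamma> + \<bar>a\<^sub>u 0\<bar> * (Q * N2 / (2 * sqrt c_\<gamma>))) * m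
            + \<bar>a\<^sub>u 0\<bar> * sqrt C_\<gamma> * (4 / (3 * \<rho>) * (l * (Q * N2) / 4) powr \<rho>) \<le> sqrt 2 * \<kappa> + J * \<bar>\<nu>\<bar> powr \<rho>"
          by (rule add_mono)
        moreover have "0 \<le> sqrt 2 * (Q * N1 * sqrt C_\<gamma> + \<bar>a\<^sub>u 0\<bar> * (Q * N2 / (2 * sqrt c_\<gamma>))) * m
            + \<bar>a\<^sub>u 0\<bar> * sqrt C_\<gamma> * (4 / (3 * \<rho>) * (l * (Q * N2) / 4) powr \<rho>)"
          using m N0 Q C_\<gamma> \<rho> g_bounds(1)
          by (intro mult_nonneg_nonneg add_nonneg_nonneg divide_nonneg_nonneg) auto
        ultimately have "(sqrt 2 * (Q * N1 * sqrt C_\<gamma> + \<bar>a\<^sub>u 0\<bar> * (Q * N2 / (2 * sqrt c_\<gamma>))) * m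
            + \<bar>a\<^sub>u 0\<bar> * sqrt C_\<gamma> * (4 / (3 * \<rho>) * (l * (Q * N2) / 4) powr \<rho>))\<^sup>2 \<le> (sqrt 2 * \<kappa> + J * \<bar>\<nu>\<bar> powr \<rho>)\<^sup>2"
          by (rule power_mono)
        with fb show ?thesis unfolding h_def 1 2 \<rho>_def[symmetric] m_def[symmetric] by (rule order_trans)
      qed
      \<comment> \<open>Changing the sign of the frequency conjugates \<open>G\<close> and so only
        swaps the two summands of \<open>h\<close>.\<close>
      have h_minus: "h (- \<nu>) = h \<nu>" for \<nu>
      proof -
        have "G u (- \<nu>) = cnj (G u \<nu>)" for u by (simp add: G_def exp_cnj)
        then show ?thesis by (simp add: h_def)
      qed
      have h_le: "h \<nu> \<le> (sqrt 2 * \<kappa> + J * \<bar>\<nu>\<bar> powr \<rho>)\<^sup>2" if "\<nu> \<noteq> 0" for \<nu>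
        using h_pos[of \<nu>] h_pos[of "- \<nu>"] h_minus[of \<nu>] that by (cases "0 < \<nu>") auto
      note SM = spectral_minkowski[OF S_nonneg S_int S_rho S_sigma \<sigma>0 I_sq I0 \<kappa>0 J0]
      have "(LBINT \<nu>. S \<nu> * h \<nu>) \<le> (LBINT \<nu>. S \<nu> * (sqrt 2 * \<kappa> + J * \<bar>\<nu>\<bar> powr \<rho>)\<^sup>2)"
      proof (rule integral_mono_AE[OF h_int SM(1)])
        show "AE \<nu> in lborel. S \<nu> * h \<nu> \<le> S \<nu> * (sqrt 2 * \<kappa> + J * \<bar>\<nu>\<bar> powr \<rho>)\<^sup>2"
          using AE_lborel_singleton[of 0] by eventually_elim (use h_le S_nonneg in \<open>auto intro!: mult_left_mono\<close>)
      qed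
      then have "Q * ((LBINT \<nu>. S \<nu> * h \<nu>) / 2) \<le> Q * (\<kappa> * \<sigma> + J * I)\<^sup>2"
        using SM(2) Q by (intro mult_left_mono) auto
      also have "\<dots> \<le> Q * (C_a * Q * (K1 * N2 + K2 * q powr (\<mu> * s) * N2 powr \<rho> + K3 * N1))\<^sup>2"
      proof (intro mult_left_mono power_mono)
        \<comment> \<open>The term with \<open>N1\<close> has no factor \<open>C_a\<close> of its
          own; it is enlarged by \<open>C_a / c_a\<close> so that \<open>C_a\<close> can be taken
          out of the whole bracket. This is the origin of \<open>c_a\<close> in
          \<open>K3\<close>.\<close>
        have "1 \<le> C_a / c_a" using C_a a_bounds(1) by simp
        then have "(Q * N1 * sqrt C_\<gamma> * m * \<sigma>) * 1 \<le> (Q * N1 * sqrt C_\<gamma> * m * \<sigma>) * (C_a / c_a)"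
          using Q N0 C_\<gamma> m \<sigma>0 by (intro mult_left_mono) auto
        moreover have "(Q * N1 * sqrt C_\<gamma> * m * \<sigma>) * (C_a / c_a) = C_a * Q * (K3 * N1)"
          by (simp add: K3_def m_def)
        moreover have "C_a * (Q * N2 / (2 * sqrt c_\<gamma>)) * m * \<sigma> = C_a * Q * (K1 * N2)"
        proof -
          have "C_a * (Q * N2 / (2 * w)) * (\<beta> / d) * \<sigma> = C_a * Q * (\<beta> * \<sigma> / (2 * d * w) * N2)" for d w :: real
            by (simp add: mult_ac)
          then show ?thesis unfolding K1_def m_def by blast
        qed
        moreover have "J * I = C_a * Q * (K2 * q powr (\<mu> * s) * N2 powr \<rho>)"
        proof -
          \<comment> \<open>This relation fixes \<mu>: with one \<open>Q\<close> taken out of the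
            bracket, the power \<open>(Q\<^sup>2) powr \<rho>\<close> leaves exactly
            \<open>q powr (\<mu> * s)\<close>.\<close>
          have "1 + \<mu> = 2 * \<rho>" using beta by (simp add: \<mu>_def \<rho>_def field_simps)
          then have "Q * q powr (\<mu> * s) = q powr (2 * \<rho> * s)"
            using q unfolding Q_def by (simp add: powr_add[symmetric] algebra_simps) (metis distrib_right mult.commute mult.left_commute mult_1)
          also have "\<dots> = (Q\<^sup>2) powr \<rho>"
            unfolding Q_def by (simp add: power2_eq_square powr_powr mult_ac flip: powr_add)
          finally have QQ: "Q * q powr (\<mu> * s) = (Q\<^sup>2) powr \<rho>" .
          have "(pi * Q\<^sup>2 * N2 / 2) powr \<rho> = (pi / 2 * Q\<^sup>2 * N2) powr \<rho>" by simp
          also have "\<dots> = (pi / 2) powr \<rho> * (Q\<^sup>2) powr \<rho> * N2 powr \<rho>"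
            by (simp only: powr_mult)
          finally show ?thesis
            unfolding J_def K2_def QQ[symmetric] by (simp add: mult_ac)
        qed
        moreover have "\<kappa> * \<sigma> = Q * N1 * sqrt C_\<gamma> * m * \<sigma> + C_a * (Q * N2 / (2 * sqrt c_\<gamma>)) * m * \<sigma>"
          unfolding \<kappa>_def by (simp only: distrib_right)
        ultimately show "\<kappa> * \<sigma> + J * I \<le> C_a * Q * (K1 * N2 + K2 * q powr (\<mu> * s) * N2 powr \<rho> + K3 * N1)"
          unfolding distrib_left by linarith
      qed (use Q \<kappa>0 \<sigma>0 J0 I0 in auto)
      also have "\<dots> = C_a\<^sup>2 * q powr (3 * s) * (K1 * N2 + K2 * q powr (\<mu> * s) * N2 powr \<rho> + K3 * N1)\<^sup>2"
      proof -
        \<comment> \<open>One \<open>Q\<close> is the square of the prefactor \<open>sqrt Q\<close>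
          of the rescaled error, the other two come from the squared bracket.\<close>
        have "Q ^ 3 = q powr (3 * s)"
          using q by (simp add: Q_def powr_power mult.commute)
        then show ?thesis
          by (simp add: power_mult_distrib power2_eq_square power3_eq_cube mult_ac flip: \<open>Q ^ 3 = q powr (3 * s)\<close>)
      qed
      finally show ?thesis unfolding energy .
    qed
    then show ?thesis using \<epsilon>_meas \<epsilon>_int by blast
  qed
  show ?thesis
    unfolding Let_def
    using field unfolding \<epsilon>_def Y_def K1_def K2_def K3_def N1_def N2_def I_def \<sigma>_def \<rho>_def \<mu>_def by blast
qed

end
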